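(* Consider SAEF-SGD (step-ahead error feedback without momentum, $\mu=0$, without error averaging, with double-way compression, as defined in the context) run for $T\ge 1$ iterations with $K\ge 1$ workers. Suppose Assumptions (A1) ($L$-Lipschitz gradient), (A2) (bounded variance), (A3) (bounded gradient) and (A4) ($\delta$-approximate compressor) of the context hold, and that the learning rate is constant, $\eta_t=\eta$ for all $t=0,\dots,T-1$, with $0<\eta<\frac{3}{4L}$. Then the auxiliary variable $\tilde{x}_t$ satisfies $$\min_{t=0,\dots,T-1}\mathbb{E}\|\nabla F(\tilde{x}_t)\|_2^2\le \frac{4[F(\tilde{x}_0)-F(x^* )]}{\eta(3-4\eta L)T}+\frac{2\eta L\sigma^2}{(3-4\eta L)K}+\frac{C(1-\delta)}{(1-\sqrt{1-\delta})^2}\,\frac{4(\eta L+1)\eta^2L^2}{3-4\eta L}(M^2+\sigma^2),$$ where $C=\frac{2(1+\delta)(2-\delta)}{(1-\sqrt{1-\delta})^2}+\frac{1+\delta}{\delta}$.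
   Context: Problem: minimize $F(x)=\mathbb{E}_{\xi\sim\mathcal{D}}f(x;\xi)$ over $x\in\mathbb{R}^d$, with unbiased stochastic gradients $\mathbb{E}_{\xi\sim\mathcal D}\nabla f(x;\xi)=\nabla F(x)$; $x^*$ denotes a minimizer of $F$. All $K$ workers sample from the same distribution $\mathcal{D}$; the samples $\xi^{(k)}_t$ ($1\le k\le K$, $0\le t\le T-1$) are independent with law $\mathcal D$. SAEF-SGD (no momentum, no error averaging). Let $\mathcal{C}:\mathbb{R}^d\to\mathbb{R}^d$ be a compression function and $\eta_t>0$ the learning rates. Start from a given $x_0\in\mathbb{R}^d$, local errors $e^{(k)}_0=0$ for $1\le k\le K$ and server error $e_0=0$. All workers hold the same model $x^{(k)}_t=x_t$. For $t=0,\dots,T-1$: each worker $k$ computes $x^{(k)}_{t+\frac12}=x_t-e^{(k)}_t$, $\Delta^{(k)}_{t+1}=e^{(k)}_t+\eta_t\nabla f(x^{(k)}_{t+\frac12};\xi^{(k)}_t)$, $e^{(k)}_{t+1}=\Delta^{(k)}_{t+1}-\mathcal{C}(\Delta^{(k)}_{t+1})$; the server computes $\Delta_{t+1}=e_t+\frac1K\sum_{k=1}^K\mathcal{C}(\Delta^{(k)}_{t+1})$, $e_{t+1}=\Delta_{t+1}-\mathcal{C}(\Delta_{t+1})$; then $x_{t+1}=x_t-\mathcal{C}(\Delta_{t+1})$ for all workers. Auxiliary variable: $\tilde{x}_t=x_t-\big(e_t+\frac1K\sum_{k=1}^K e^{(k)}_t\big)$. Assumptions. (A1) $F$ is differentiable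 and $\|\nabla F(x)-\nabla F(y)\|_2\le L\|x-y\|_2$ for all $x,y\in\mathbb{R}^d$. (A2) $\mathbb{E}\|\nabla f(x;\xi^{(k)}_t)-\nabla F(x)\|_2^2\le\sigma^2$ at the iterates $x=x^{(k)}_t$ and $x=x^{(k)}_{t+\frac12}$, for all $k,t$. (A3) $\|\nabla F(x)\|_2^2\le M^2$ at the iterates $x=x^{(k)}_t$ and $x=x^{(k)}_{t+\frac12}$, for all $k,t$. (A4) $0<\delta\le1$ and $\|\mathcal{C}(v)-v\|_2^2\le(1-\delta)\|v\|_2^2$ for all $v\in\mathbb{R}^d$. *)

theory Defs
  imports "HOL-Probability.Probability"
begin

definition grad :: "('a::euclidean_space \<Rightarrow> real) \<Rightarrow> 'a \<Rightarrow> 'a" where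
  "grad f x = (THE g. GDERIV f x :> g)"

definition stoch_grad :: "('a::euclidean_space \<Rightarrow> 's \<Rightarrow> real) \<Rightarrow> 'a \<Rightarrow> 's \<Rightarrow> 'a" where
  "stoch_grad f x s = grad (\<lambda>y. f y s) x"

text \<open>
  A state of SAEF-SGD: the model \<open>x\<^sub>t\<close> shared by all workers, the local errors of the
  workers \<open>k = 1, ..., K\<close> and the server error.
\<close>

record 'a saef_state =
  model :: 'a
  worker_err :: "nat \<Rightarrow> 'a"
  server_err :: 'a

definition saef_init :: "'a::euclidean_space \<Rightarrow> 'a saef_state" where
  "saef_init x0 = \<lparr>model = x0, worker_err = (\<lambda>k. 0), server_err = 0\<rparr>"

text \<open>The step-ahead model of worker \<open>k\<close>, with time index \<open>t + 1/2\<close>.\<close>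

definition half_model :: "'a::euclidean_space saef_state \<Rightarrow> nat \<Rightarrow> 'a" where
  "half_model S k = model S - worker_err S k"

text \<open>
  One iteration with compressor \<open>Comp\<close>, stochastic gradient oracle \<open>G\<close>, learning rate
  \<open>h\<close>, \<open>K\<close> workers, and \<open>s k\<close> the sample drawn by worker \<open>k\<close>.
\<close>

definition saef_step ::
  "('a::euclidean_space \<Rightarrow> 'a) \<Rightarrow> ('a \<Rightarrow> 's \<Rightarrow> 'a) \<Rightarrow> real \<Rightarrow> nat \<Rightarrow> (nat \<Rightarrow> 's) \<Rightarrow> 'a saef_state \<Rightarrow> 'a saef_state"
where
  "saef_step Comp G h K s S =
    (let \<Delta> = (\<lambda>k. worker_err S k + h *\<^sub>R G (half_model S k) (s k));
         \<Delta>\<^sub>0 = server_err S + (1 / real K) *\<^sub>R (\<Sum>k = 1..K. Comp (\<Delta> k))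
     in \<lparr>model = model S - Comp \<Delta>\<^sub>0,
         worker_err = (\<lambda>k. \<Delta> k - Comp (\<Delta> k)),
         server_err = \<Delta>\<^sub>0 - Comp \<Delta>\<^sub>0\<rparr>)"

text \<open>
  The state after a number of iterations along one sample path; \<open>\<xi> k t\<close> is the sample of
  worker \<open>k\<close> at time \<open>t\<close>.
\<close>

primrec saef ::
  "('a::euclidean_space \<Rightarrow> 'a) \<Rightarrow> ('a \<Rightarrow> 's \<Rightarrow> 'a) \<Rightarrow> (nat \<Rightarrow> real) \<Rightarrow> nat \<Rightarrow> 'a \<Rightarrow> (nat \<Rightarrow> nat \<Rightarrow> 's) \<Rightarrow> nat \<Rightarrow> 'a saef_state"
where
  "saef Comp G \<eta> K x0 \<xi> 0 = saef_init x0"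
| "saef Comp G \<eta> K x0 \<xi> (Suc t) =
     saef_step Comp G (\<eta> t) K (\<lambda>k. \<xi> k t) (saef Comp G \<eta> K x0 \<xi> t)"

definition aux_model :: "nat \<Rightarrow> 'a::euclidean_space saef_state \<Rightarrow> 'a" where
  "aux_model K S =
     model S - (server_err S + (1 / real K) *\<^sub>R (\<Sum>k = 1..K. worker_err S k))"

text \<open>
  The Bochner integral of a non-integrable function is 0, so a bound on an expectation
  has to include integrability.
\<close>

definition expectation_le :: "'w measure \<Rightarrow> ('w \<Rightarrow> real) \<Rightarrow> real \<Rightarrow> bool" where
  "expectation_le P X b \<longleftrightarrow> integrable P X \<and> (\<integral>\<omega>. X \<omega> \<partial>P) \<le> b"

end

theory Submission
  imports Defs
begin

text \<open>Write \<open>a = sqrt (1 - \<delta>)\<close>. The auxiliary variable performs the exact recursion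
  \<open>z (t + 1) = z t - \<eta> \<cdot> (1/K) \<Sum>\<^sub>k g t k\<close>, where \<open>g t k\<close> is the stochastic gradient at the
  step-ahead model of worker \<open>k\<close>; all compression is hidden in the distance between \<open>z t\<close> and the
  step-ahead models. The descent lemma, the orthogonality of the gradient noises to the past and to each
  other, and an elementary inequality give a decrease of \<open>F (z t)\<close> by
  \<open>\<eta> (3 - 4 \<eta> L) / 4\<close> times the squared gradient norm, up to the noise of the mean gradient and \<open>L\<^sup>2\<close>
  times the mean squared distance. The latter is at most the mean square of the worker errors plus the
  square of the server error, since subtracting the mean of the worker errors only helps. An error
  sequence that contracts as \<open>|e'| \<le> a |e + v|\<close> with \<open>E |v|\<^sup>2 \<le> B\<close> satisfies
  \<open>E |e + v|\<^sup>2 \<le> B / (1 - a)\<^sup>2\<close>; applied to each worker and then to the server, whose input is the mean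
  of the compressed worker vectors, this bounds both errors.\<close>

section \<open>Gradients\<close>

text \<open>The definite description in \<open>grad\<close> needs existence and uniqueness. The
  Riesz vector, whose coordinates are the values of \<open>f'\<close> on the basis, represents the
  derivative; two representing vectors agree because the derivative is unique.\<close>

lemma gderiv_grad:
  fixes f :: "'a::euclidean_space \<Rightarrow> real"
  assumes "f differentiable (at x)"
  shows "GDERIV f x :> grad f x"
proof -
  from assms obtain f' where f': "(f has_derivative f') (at x)"
    by (auto simp: differentiable_def)
  then have lin: "linear f'"
    by (rule has_derivative_linear)
  define g where "g = (\<Sum>b\<in>Basis. f' b *\<^sub>R b)"
  have "f' = (\<lambda>h. inner h g)"
  proof
    fix h
    have "f' h = f' (\<Sum>b\<in>Basis. inner h b *\<^sub>R b)"
      by (simp add: euclidean_representation)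
    also have "\<dots> = (\<Sum>b\<in>Basis. inner h b * f' b)"
      using lin by (simp add: linear_sum linear_cmul)
    also have "\<dots> = inner h g"
      by (simp add: g_def inner_sum_right mult.commute)
    finally show "f' h = inner h g" .
  qed
  with f' have g: "GDERIV f x :> g"
    by (simp add: gderiv_def)
  moreover have "g' = g" if "GDERIV f x :> g'" for g'
  proof -
    have "(\<lambda>h. inner h g') = (\<lambda>h. inner h g)"
      using that g unfolding gderiv_def by (rule has_derivative_unique)
    then show ?thesis
      by (metis vector_eq_ldot)
  qed
  ultimately show ?thesis
    unfolding grad_def by (metis (mono_tags, lifting) theI)
qed

text \<open>Let \<open>\<phi>\<close> be \<open>F\<close> along the segment from \<open>x\<close> to
  \<open>y\<close>, minus the linear and the quadratic term of the bound. Cauchy-Schwarz and the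
  Lipschitz gradient make its derivative nonpositive on the unit interval, and
  \<open>\<phi> 1 \<le> \<phi> 0\<close> is the claim.\<close>

lemma descent_lemma:
  fixes F :: "'a::euclidean_space \<Rightarrow> real"
  assumes diff: "\<And>x. F differentiable (at x)"
    and lip: "\<And>x y. norm (grad F x - grad F y) \<le> L * norm (x - y)"
  shows "F y \<le> F x + inner (grad F x) (y - x) + L / 2 * (norm (y - x))\<^sup>2"
proof -
  define v where "v = y - x"
  define \<phi> where "\<phi> = (\<lambda>t. F (x + t *\<^sub>R v) - t * inner (grad F x) v - L / 2 * t\<^sup>2 * (norm v)\<^sup>2)"
  have der: "(\<phi> has_real_derivative
      inner v (grad F (x + t *\<^sub>R v)) - inner (grad F x) v - L * t * (norm v)\<^sup>2) (at t)" for t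
  proof -
    have 1: "((\<lambda>t. x + t *\<^sub>R v) has_derivative (\<lambda>h. h *\<^sub>R v)) (at t)"
      by (auto intro!: derivative_eq_intros)
    have 2: "(F has_derivative (\<lambda>h. inner h (grad F (x + t *\<^sub>R v)))) (at (x + t *\<^sub>R v))"
      using gderiv_grad[OF diff] by (simp add: gderiv_def)
    have "((\<lambda>t. F (x + t *\<^sub>R v)) has_derivative
        (\<lambda>h. inner (h *\<^sub>R v) (grad F (x + t *\<^sub>R v)))) (at t)"
      using has_derivative_compose[OF 1 2] .
    then have "((\<lambda>t. F (x + t *\<^sub>R v)) has_real_derivative
        inner v (grad F (x + t *\<^sub>R v))) (at t)"
      by (simp add: has_field_derivative_def mult_commute_abs)
    then show ?thesis
      unfolding \<phi>_def by (auto intro!: derivative_eq_intros)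
  qed
  have "\<phi> 1 \<le> \<phi> 0"
  proof (rule DERIV_nonpos_imp_nonincreasing[where f = \<phi>])
    fix t :: real
    assume t: "0 \<le> t" "t \<le> 1"
    have "inner v (grad F (x + t *\<^sub>R v)) - inner (grad F x) v
        = inner v (grad F (x + t *\<^sub>R v) - grad F x)"
      by (simp add: inner_diff_right inner_commute)
    also have "\<dots> \<le> norm v * norm (grad F (x + t *\<^sub>R v) - grad F x)"
      by (rule norm_cauchy_schwarz)
    also have "\<dots> \<le> norm v * (L * norm (t *\<^sub>R v))"
      using lip[of "x + t *\<^sub>R v" x] by (intro mult_left_mono) auto
    also have "\<dots> = L * t * (norm v)\<^sup>2"
      using t by (simp add: power2_eq_square)
    finally show "\<exists>d. DERIV \<phi> t :> d \<and> d \<le> 0"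
      using der[of t] by auto
  qed simp
  then show ?thesis
    by (simp add: \<phi>_def v_def)
qed

text \<open>Simple functions \<open>q i\<close> approximate the first argument. Each takes finitely
  many values, so \<open>g (q i x) s\<close> is pieced together from measurable sections; continuity
  in \<open>x\<close> then passes to the limit.\<close>

lemma borel_measurable_Caratheodory:
  fixes g :: "'a::{second_countable_topology, metric_space} \<Rightarrow> 's \<Rightarrow> real"
  assumes meas: "\<And>x. g x \<in> borel_measurable N"
    and cont: "\<And>s. s \<in> space N \<Longrightarrow> continuous_on UNIV (\<lambda>x. g x s)"
  shows "(\<lambda>p. g (fst p) (snd p)) \<in> borel_measurable (borel \<Otimes>\<^sub>M N)"
proof -
  have "(\<lambda>x::'a. x) \<in> borel_measurable borel"
    by simp
  from borel_measurable_implies_sequence_metric[OF this, of undefined]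
  obtain q :: "nat \<Rightarrow> 'a \<Rightarrow> 'a" where q: "\<And>i. simple_function borel (q i)"
    "\<And>x. (\<lambda>i. q i x) \<longlonglongrightarrow> x"
    by auto
  have "(\<lambda>p. g (q i (fst p)) (snd p)) \<in> borel_measurable (borel \<Otimes>\<^sub>M N)" for i
  proof (rule measurable_compose_countable'[where I = "range (q i)"])
    show "countable (range (q i))"
      using simple_functionD(1)[OF q(1)[of i]] by (simp add: countable_finite)
    have "q i \<in> measurable borel (count_space (range (q i)))"
      using q(1)[of i] simple_functionD(1)[OF q(1)[of i]]
      by (simp add: measurable_count_space_eq2 simple_function_def)
    then show "(\<lambda>p. q i (fst p)) \<in> measurable (borel \<Otimes>\<^sub>M N) (count_space (range (q i)))"
      by measurable
    show "(\<lambda>p. g x (snd p)) \<in> borel_measurable (borel \<Otimes>\<^sub>M N)" for x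
      using meas[of x] by measurable
  qed
  moreover have "(\<lambda>i. g (q i (fst p)) (snd p)) \<longlonglongrightarrow> g (fst p) (snd p)"
    if "p \<in> space (borel \<Otimes>\<^sub>M N)" for p
  proof -
    have "isCont (\<lambda>x. g x (snd p)) (fst p)"
      using that cont[of "snd p"] by (auto simp: space_pair_measure continuous_on_eq_continuous_at)
    then show ?thesis
      using q(2)[of "fst p"] by (rule isCont_tendsto_compose)
  qed
  ultimately show ?thesis
    by (rule borel_measurable_LIMSEQ_metric)
qed

text \<open>The component of the gradient in direction \<open>b\<close> is the pointwise limit of
  difference quotients with step \<open>1 / (i + 1)\<close>. These are jointly measurable because
  \<open>f\<close> is, being differentiable and hence continuous in its first argument.\<close>

lemma borel_measurable_stoch_grad:
  fixes f :: "'a::euclidean_space \<Rightarrow> 's \<Rightarrow> real"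
  assumes meas: "\<And>x. f x \<in> borel_measurable N"
    and diff: "\<And>x s. s \<in> space N \<Longrightarrow> (\<lambda>y. f y s) differentiable (at x)"
  shows "(\<lambda>p. stoch_grad f (fst p) (snd p)) \<in> borel_measurable (borel \<Otimes>\<^sub>M N)"
proof -
  have f: "(\<lambda>p. f (fst p) (snd p)) \<in> borel_measurable (borel \<Otimes>\<^sub>M N)"
    using diff by (intro borel_measurable_Caratheodory meas)
      (auto simp: continuous_on_eq_continuous_at intro: differentiable_imp_continuous_within)
  have "(\<lambda>p. inner (stoch_grad f (fst p) (snd p)) b) \<in> borel_measurable (borel \<Otimes>\<^sub>M N)" for b
  proof (rule borel_measurable_LIMSEQ_metric)
    fix i :: nat
    define \<epsilon> where "\<epsilon> = 1 / real (Suc i)"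
    have "(\<lambda>p. (fst p + \<epsilon> *\<^sub>R b, snd p)) \<in> measurable (borel \<Otimes>\<^sub>M N) (borel \<Otimes>\<^sub>M N)"
      by measurable
    from measurable_compose[OF this f]
    show "(\<lambda>p. (f (fst p + (1 / real (Suc i)) *\<^sub>R b) (snd p) - f (fst p) (snd p)) / (1 / real (Suc i)))
        \<in> borel_measurable (borel \<Otimes>\<^sub>M N)"
      using f unfolding \<epsilon>_def by (intro borel_measurable_divide borel_measurable_diff) auto
  next
    fix p :: "'a \<times> 's"
    assume p: "p \<in> space (borel \<Otimes>\<^sub>M N)"
    define x s where "x = fst p" and "s = snd p"
    have 1: "((\<lambda>t. x + t *\<^sub>R b) has_derivative (\<lambda>h. h *\<^sub>R b)) (at (0::real))"
      by (auto intro!: derivative_eq_intros)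
    have 2: "((\<lambda>y. f y s) has_derivative (\<lambda>h. inner h (stoch_grad f x s))) (at (x + 0 *\<^sub>R b))"
      using gderiv_grad[OF diff] p
      by (auto simp: gderiv_def stoch_grad_def s_def space_pair_measure)
    have "((\<lambda>t. f (x + t *\<^sub>R b) s) has_real_derivative inner (stoch_grad f x s) b) (at 0)"
      using has_derivative_compose[OF 1 2]
      by (simp add: has_field_derivative_def inner_commute mult_commute_abs)
    then have "((\<lambda>h. (f (x + h *\<^sub>R b) s - f x s) / h) \<longlongrightarrow> inner (stoch_grad f x s) b) (at 0)"
      by (simp add: DERIV_def)
    moreover have "filterlim (\<lambda>i. 1 / real (Suc i)) (at 0) sequentially"
      unfolding filterlim_at using LIMSEQ_inverse_real_of_nat by (auto simp: inverse_eq_divide)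
    ultimately show "(\<lambda>i. (f (fst p + (1 / real (Suc i)) *\<^sub>R b) (snd p) - f (fst p) (snd p)) / (1 / real (Suc i)))
        \<longlonglongrightarrow> inner (stoch_grad f (fst p) (snd p)) b"
      unfolding x_def s_def by (rule filterlim_compose)
  qed
  then show ?thesis
    by (subst borel_measurable_euclidean_space) simp
qed

section \<open>Orthogonality from independence\<close>

text \<open>Independence makes the joint law a product, so Fubini can integrate over
  \<open>Y\<close> first, where the integral vanishes. This takes the place of conditional
  expectations: \<open>X\<close> is the past and \<open>Y\<close> a fresh sample.\<close>

lemma (in prob_space) integral_indep_eq_0:
  fixes h :: "('b \<times> 'b) \<Rightarrow> real"
  assumes ind: "indep_var N1 X N2 Y"
    and meas: "h \<in> borel_measurable (N1 \<Otimes>\<^sub>M N2)"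
    and int: "integrable M (\<lambda>\<omega>. h (X \<omega>, Y \<omega>))"
    and zero: "\<And>x. x \<in> space N1 \<Longrightarrow> (\<integral>y. h (x, y) \<partial>distr M N2 Y) = 0"
  shows "(\<integral>\<omega>. h (X \<omega>, Y \<omega>) \<partial>M) = 0"
proof -
  have rv: "random_variable N1 X" "random_variable N2 Y"
    and eq: "distr M N1 X \<Otimes>\<^sub>M distr M N2 Y = distr M (N1 \<Otimes>\<^sub>M N2) (\<lambda>\<omega>. (X \<omega>, Y \<omega>))"
    using ind by (auto simp: indep_var_distribution_eq)
  interpret X: prob_space "distr M N1 X" using rv(1) by (rule prob_space_distr)
  interpret Y: prob_space "distr M N2 Y" using rv(2) by (rule prob_space_distr)
  interpret XY: pair_sigma_finite "distr M N1 X" "distr M N2 Y" ..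
  have XY: "(\<lambda>\<omega>. (X \<omega>, Y \<omega>)) \<in> measurable M (N1 \<Otimes>\<^sub>M N2)"
    using rv by measurable
  have "(\<integral>\<omega>. h (X \<omega>, Y \<omega>) \<partial>M) = integral\<^sup>L (distr M N1 X \<Otimes>\<^sub>M distr M N2 Y) h"
    unfolding eq by (rule integral_distr[symmetric]) (use XY meas in auto)
  also have "\<dots> = (\<integral>x. (\<integral>y. h (x, y) \<partial>distr M N2 Y) \<partial>distr M N1 X)"
    using int meas XY by (intro XY.integral_fst'[symmetric]) (simp add: eq integrable_distr_eq)
  also have "\<dots> = (\<integral>x. 0 \<partial>distr M N1 X)"
    by (intro Bochner_Integration.integral_cong) (auto simp: zero)
  finally show ?thesis
    by simp
qed

lemma (in prob_space) integral_indep_vars_eq_0: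
  fixes h :: "('i \<Rightarrow> 'b) \<times> 'b \<Rightarrow> real"
  assumes ind: "indep_vars (\<lambda>_. N) X I" and A: "A \<subseteq> I" and i: "i \<in> I" "i \<notin> A"
    and meas: "h \<in> borel_measurable (PiM A (\<lambda>_. N) \<Otimes>\<^sub>M N)"
    and int: "integrable M (\<lambda>\<omega>. h (\<lambda>j\<in>A. X j \<omega>, X i \<omega>))"
    and zero: "\<And>p. p \<in> space (PiM A (\<lambda>_. N)) \<Longrightarrow> (\<integral>y. h (p, y) \<partial>distr M N (X i)) = 0"
  shows "(\<integral>\<omega>. h (\<lambda>j\<in>A. X j \<omega>, X i \<omega>) \<partial>M) = 0"
proof -
  \<comment> \<open>Independence of disjoint groups of indices is stated for restricted families.
    The single index \<open>i\<close> therefore becomes the group \<open>{i}\<close>, and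
    \<open>?h\<close> reads off its only coordinate.\<close>
  let ?Y = "\<lambda>\<omega>. \<lambda>j\<in>{i}. X j \<omega>" and ?h = "\<lambda>(p, y). h (p, y i)"
  have rv: "random_variable N (X i)"
    using ind i by (auto simp: indep_vars_def)
  then have rvY: "random_variable (PiM {i} (\<lambda>_. N)) ?Y"
    by (intro measurable_restrict) auto
  have measY: "?h \<in> borel_measurable (PiM A (\<lambda>_. N) \<Otimes>\<^sub>M PiM {i} (\<lambda>_. N))"
    using meas by measurable
  have "(\<integral>\<omega>. ?h (\<lambda>j\<in>A. X j \<omega>, ?Y \<omega>) \<partial>M) = 0"
  proof (rule integral_indep_eq_0[OF _ measY])
    show "indep_var (PiM A (\<lambda>_. N)) (\<lambda>\<omega>. \<lambda>j\<in>A. X j \<omega>) (PiM {i} (\<lambda>_. N)) ?Y"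
      using i by (intro indep_var_restrict[OF ind _ A]) auto
    show "integrable M (\<lambda>\<omega>. ?h (\<lambda>j\<in>A. X j \<omega>, ?Y \<omega>))"
      using int by simp
  next
    fix p assume p: "p \<in> space (PiM A (\<lambda>_. N))"
    have h: "(\<lambda>y. h (p, y)) \<in> borel_measurable N"
      using meas p by (rule measurable_Pair2)
    have "(\<lambda>y. y i) \<in> measurable (PiM {i} (\<lambda>_. N)) N"
      by measurable
    then have "(\<integral>y. ?h (p, y) \<partial>distr M (PiM {i} (\<lambda>_. N)) ?Y) = (\<integral>\<omega>. h (p, X i \<omega>) \<partial>M)"
      using h by (subst integral_distr[OF rvY]) (auto intro: measurable_compose)
    also have "\<dots> = (\<integral>y. h (p, y) \<partial>distr M N (X i))"
      by (rule integral_distr[OF rv h, symmetric])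
    finally show "(\<integral>y. ?h (p, y) \<partial>distr M (PiM {i} (\<lambda>_. N)) ?Y) = 0"
      using zero[OF p] by simp
  qed
  then show ?thesis
    by simp
qed

section \<open>Square-integrable random vectors\<close>

text \<open>Measurability of \<open>X\<close> is included because that of its squared norm alone
  would not make sums and inner products measurable.\<close>

definition square_integrable :: "'w measure \<Rightarrow> ('w \<Rightarrow> 'a::euclidean_space) \<Rightarrow> bool" where
  "square_integrable N X \<longleftrightarrow>
     X \<in> borel_measurable N \<and> integrable N (\<lambda>\<omega>. (norm (X \<omega>))\<^sup>2)"

lemma square_integrable_measurable: "square_integrable N X \<Longrightarrow> X \<in> borel_measurable N"
  and square_integrable_norm: "square_integrable N X \<Longrightarrow> integrable N (\<lambda>\<omega>. (norm (X \<omega>))\<^sup>2)"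
  by (simp_all add: square_integrable_def)

lemma square_integrable_bound:
  assumes "X \<in> borel_measurable N" "integrable N Y" "AE \<omega> in N. (norm (X \<omega>))\<^sup>2 \<le> Y \<omega>"
  shows "square_integrable N X"
  unfolding square_integrable_def
proof
  show "integrable N (\<lambda>\<omega>. (norm (X \<omega>))\<^sup>2)"
  proof (rule Bochner_Integration.integrable_bound[OF assms(2)])
    show "AE \<omega> in N. norm ((norm (X \<omega>))\<^sup>2) \<le> norm (Y \<omega>)"
      using assms(3) by eventually_elim auto
  qed (use assms(1) in measurable)
qed (rule assms)

lemma norm_add_power2_le: "(norm (x + y))\<^sup>2 \<le> 2 * (norm x)\<^sup>2 + 2 * (norm (y::'a::real_inner))\<^sup>2"
proof -
  have "0 \<le> (norm (x - y))\<^sup>2" by simp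
  then show ?thesis
    by (simp add: power2_norm_eq_inner algebra_simps inner_commute)
qed

lemma square_integrable_add:
  assumes "square_integrable N X" "square_integrable N Y"
  shows "square_integrable N (\<lambda>\<omega>. X \<omega> + Y \<omega>)"
proof (rule square_integrable_bound)
  show "integrable N (\<lambda>\<omega>. 2 * (norm (X \<omega>))\<^sup>2 + 2 * (norm (Y \<omega>))\<^sup>2)"
    using assms by (simp add: square_integrable_def)
qed (use assms in \<open>auto simp: square_integrable_def norm_add_power2_le\<close>)

lemma square_integrable_scaleR:
  "square_integrable N X \<Longrightarrow> square_integrable N (\<lambda>\<omega>. c *\<^sub>R X \<omega>)"
  by (auto simp: square_integrable_def power_mult_distrib intro!: borel_measurable_scaleR)

lemma square_integrable_diff:
  assumes "square_integrable N X" "square_integrable N Y"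
  shows "square_integrable N (\<lambda>\<omega>. X \<omega> - Y \<omega>)"
  using square_integrable_add[OF assms(1) square_integrable_scaleR[OF assms(2), of "-1"]] by simp

lemma square_integrable_sum:
  "(\<And>i. i \<in> I \<Longrightarrow> square_integrable N (X i)) \<Longrightarrow> square_integrable N (\<lambda>\<omega>. \<Sum>i\<in>I. X i \<omega>)"
  by (induction I rule: infinite_finite_induct)
    (auto intro!: square_integrable_add simp: square_integrable_def[of _ "\<lambda>_. 0"])

lemma (in prob_space) square_integrable_const: "square_integrable M (\<lambda>_. c)"
  by (simp add: square_integrable_def)

lemma integrable_inner_square_integrable:
  fixes X Y :: "'w \<Rightarrow> 'a::euclidean_space"
  assumes "square_integrable N X" "square_integrable N Y"
  shows "integrable N (\<lambda>\<omega>. inner (X \<omega>) (Y \<omega>))"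
proof (rule Bochner_Integration.integrable_bound)
  show "integrable N (\<lambda>\<omega>. (norm (X \<omega>))\<^sup>2 + (norm (Y \<omega>))\<^sup>2)"
    using assms by (simp add: square_integrable_def)
  show "(\<lambda>\<omega>. inner (X \<omega>) (Y \<omega>)) \<in> borel_measurable N"
    using assms by (auto simp: square_integrable_def)
  have "\<bar>inner x y\<bar> \<le> (norm x)\<^sup>2 + (norm y)\<^sup>2" for x y :: 'a
  proof -
    have "\<bar>inner x y\<bar> \<le> norm x * norm y"
      by (rule Cauchy_Schwarz_ineq2)
    also have "\<dots> \<le> 2 * (norm x * norm y)"
      by simp
    also have "\<dots> \<le> (norm x)\<^sup>2 + (norm y)\<^sup>2"
      using sum_squares_bound[of "norm x" "norm y"] by simp
    finally show ?thesis .
  qed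
  then show "AE \<omega> in N. norm (inner (X \<omega>) (Y \<omega>)) \<le> norm ((norm (X \<omega>))\<^sup>2 + (norm (Y \<omega>))\<^sup>2)"
    by (auto intro!: AE_I2 order_trans[OF _ abs_ge_self])
qed

lemma norm_mean_power2_le:
  fixes u :: "'i \<Rightarrow> 'a::real_normed_vector"
  shows "(norm ((1 / real (card I)) *\<^sub>R (\<Sum>i\<in>I. u i)))\<^sup>2 \<le> (1 / real (card I)) * (\<Sum>i\<in>I. (norm (u i))\<^sup>2)"
\<comment> \<open>When \<open>card I = 0\<close>, which includes infinite \<open>I\<close>, the
  convention \<open>1 / 0 = 0\<close> makes both sides zero.\<close>
proof (cases "card I = 0")
  case False
  have "(norm (\<Sum>i\<in>I. u i))\<^sup>2 \<le> (\<Sum>i\<in>I. norm (u i))\<^sup>2"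
    by (intro power_mono norm_sum) simp
  also have "\<dots> \<le> real (card I) * (\<Sum>i\<in>I. (norm (u i))\<^sup>2)"
    using sum_squared_le_sum_of_squares[of "\<lambda>i. norm (u i)" I] by (simp add: mult.commute)
  finally show ?thesis
    using False by (simp add: power_mult_distrib power2_eq_square field_simps)
qed simp

text \<open>The deviations from the mean \<open>m\<close> sum to zero, so the shift by
  \<open>c\<close> produces no cross term: the left side equals the sum of squares plus
  \<open>card I\<close> times the difference of the squared norms of \<open>c\<close> and
  \<open>m\<close>. With worker errors as \<open>u\<close> and the server error as \<open>c\<close>,
  no factor 2 is lost in separating them.\<close>

lemma sum_power2_deviation_le:
  fixes u :: "'i \<Rightarrow> 'a::real_inner"
  shows "(\<Sum>i\<in>I. (norm (u i - (c + (1 / real (card I)) *\<^sub>R (\<Sum>j\<in>I. u j))))\<^sup>2)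
    \<le> (\<Sum>i\<in>I. (norm (u i))\<^sup>2) + real (card I) * (norm c)\<^sup>2"
proof (cases "card I = 0")
  case False
  define m where "m = (1 / real (card I)) *\<^sub>R (\<Sum>j\<in>I. u j)"
  have m: "(\<Sum>j\<in>I. u j) = real (card I) *\<^sub>R m"
    using False by (simp add: m_def)
  have "(\<Sum>i\<in>I. (norm (u i - (c + m)))\<^sup>2)
      = (\<Sum>i\<in>I. (norm (u i))\<^sup>2 - 2 * inner (u i) (c + m) + (norm (c + m))\<^sup>2)"
    by (intro sum.cong refl) (simp add: power2_norm_eq_inner inner_commute algebra_simps)
  also have "\<dots> = (\<Sum>i\<in>I. (norm (u i))\<^sup>2) - 2 * inner (\<Sum>i\<in>I. u i) (c + m)
      + real (card I) * (norm (c + m))\<^sup>2"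
    by (simp add: sum.distrib sum_subtractf inner_sum_left sum_distrib_left)
  also have "\<dots> = (\<Sum>i\<in>I. (norm (u i))\<^sup>2) + real (card I) * ((norm c)\<^sup>2 - (norm m)\<^sup>2)"
    by (simp add: m power2_norm_eq_inner inner_commute algebra_simps)
  also have "\<dots> \<le> (\<Sum>i\<in>I. (norm (u i))\<^sup>2) + real (card I) * (norm c)\<^sup>2"
    by (intro add_left_mono mult_left_mono) auto
  finally show ?thesis
    by (simp add: m_def)
qed (auto simp: card_eq_0_iff)

text \<open>Here \<open>a\<close> is the gradient at the auxiliary variable and \<open>b\<close> the
  mean gradient actually followed. With \<open>d = b - a\<close>, the term
  \<open>- inner a d\<close> costs a quarter of the square of \<open>a\<close> plus the square of
  \<open>d\<close>, which leaves the 3/4. Splitting the square of \<open>b\<close> with factor 2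
  costs \<open>L * \<eta>\<^sup>2\<close> for each of the two squares.\<close>

lemma biased_gradient_step_le:
  fixes a b :: "'a::real_inner"
  assumes "0 \<le> \<eta>" "0 \<le> L"
  shows "- \<eta> * inner a b + L * \<eta>\<^sup>2 / 2 * (norm b)\<^sup>2
    \<le> - (\<eta> * (3 - 4 * \<eta> * L) / 4) * (norm a)\<^sup>2 + \<eta> * (\<eta> * L + 1) * (norm (b - a))\<^sup>2"
proof -
  define d where "d = b - a"
  have b: "b = a + d" by (simp add: d_def)
  have "0 \<le> (norm ((1/2) *\<^sub>R a + d))\<^sup>2" by simp
  then have "0 \<le> (norm a)\<^sup>2 / 4 + inner a d + (norm d)\<^sup>2"
    by (simp add: power2_norm_eq_inner inner_commute algebra_simps)
  then have 1: "0 \<le> \<eta> * ((norm a)\<^sup>2 / 4 + inner a d + (norm d)\<^sup>2)"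
    using assms by simp
  have "(norm b)\<^sup>2 \<le> 2 * (norm a)\<^sup>2 + 2 * (norm d)\<^sup>2"
    unfolding b by (rule norm_add_power2_le)
  then have 2: "L * \<eta>\<^sup>2 / 2 * (norm b)\<^sup>2 \<le> L * \<eta>\<^sup>2 / 2 * (2 * (norm a)\<^sup>2 + 2 * (norm d)\<^sup>2)"
    using assms by (intro mult_left_mono) auto
  have "inner a b = (norm a)\<^sup>2 + inner a d"
    by (simp add: b inner_add_right power2_norm_eq_inner)
  then have "- \<eta> * inner a b + L * \<eta>\<^sup>2 / 2 * (norm b)\<^sup>2
      \<le> - \<eta> * ((norm a)\<^sup>2 + inner a d) + \<eta> * ((norm a)\<^sup>2 / 4 + inner a d + (norm d)\<^sup>2)
        + L * \<eta>\<^sup>2 / 2 * (2 * (norm a)\<^sup>2 + 2 * (norm d)\<^sup>2)"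
    using 1 2 by simp
  also have "\<dots> = - (\<eta> * (3 - 4 * \<eta> * L) / 4) * (norm a)\<^sup>2 + \<eta> * (\<eta> * L + 1) * (norm d)\<^sup>2"
    by (simp add: field_simps power2_eq_square)
  finally show ?thesis
    by (simp add: d_def)
qed

text \<open>Convexity of the square for \<open>a * x + (1 - a) * (y / (1 - a))\<close>. The old
  square keeps a coefficient below 1, so the error recursion built on it stays bounded.\<close>

lemma convex_power2_le:
  fixes a x y :: real
  assumes "0 \<le> a" "a < 1"
  shows "(a * x + y)\<^sup>2 \<le> a * x\<^sup>2 + y\<^sup>2 / (1 - a)"
proof -
  have "(a * x\<^sup>2 * (1 - a) + y\<^sup>2) - (1 - a) * (a * x + y)\<^sup>2 = a * ((1 - a) * x - y)\<^sup>2"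
    by (simp add: algebra_simps power2_eq_square)
  also have "\<dots> \<ge> 0" using assms by simp
  finally show ?thesis using assms by (simp add: field_simps)
qed

section \<open>Error feedback\<close>

text \<open>The triangle inequality and \<open>convex_power2_le\<close> bound the second moment of
  \<open>e + v\<close> at the next time by \<open>a\<close> times the current one plus
  \<open>B / (1 - a)\<close>. Induction with the fixed point of this recursion gives a bound uniform
  in time. Square-integrability is carried along, since monotonicity of the integral needs
  it.\<close>

lemma (in prob_space) error_feedback:
  fixes e v :: "nat \<Rightarrow> 'a \<Rightarrow> 'b::euclidean_space"
  assumes a: "0 \<le> a" "a < 1" and B: "0 \<le> B"
    and e_0: "\<And>\<omega>. e 0 \<omega> = 0"
    and e_Suc: "\<And>t \<omega>. t < T \<Longrightarrow> norm (e (Suc t) \<omega>) \<le> a * norm (e t \<omega> + v t \<omega>)"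
    and e_meas: "\<And>t. t \<le> T \<Longrightarrow> e t \<in> borel_measurable M"
    and v: "\<And>t. t < T \<Longrightarrow> square_integrable M (v t)"
    and v_le: "\<And>t. t < T \<Longrightarrow> expectation (\<lambda>\<omega>. (norm (v t \<omega>))\<^sup>2) \<le> B"
  shows error_feedback_step:
      "t < T \<Longrightarrow> square_integrable M (\<lambda>\<omega>. e t \<omega> + v t \<omega>) \<and>
         expectation (\<lambda>\<omega>. (norm (e t \<omega> + v t \<omega>))\<^sup>2) \<le> B / (1 - a)\<^sup>2" (is "_ \<Longrightarrow> ?P t")
    and error_feedback_error:
      "t \<le> T \<Longrightarrow> square_integrable M (e t) \<and>
         expectation (\<lambda>\<omega>. (norm (e t \<omega>))\<^sup>2) \<le> a\<^sup>2 * B / (1 - a)\<^sup>2" (is "_ \<Longrightarrow> ?Q t")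
proof -
  have e_sq: "(norm (e (Suc t) \<omega>))\<^sup>2 \<le> a\<^sup>2 * (norm (e t \<omega> + v t \<omega>))\<^sup>2" if "t < T" for t \<omega>
    using power_mono[OF e_Suc[OF that], of _ 2] by (simp add: power_mult_distrib)
  \<comment> \<open>Compressing \<open>e t + v t\<close> gains the factor \<open>a\<^sup>2\<close>,
    which separates the bound on the error from the bound on the compressor's input.\<close>
  have Q_Suc: "?Q (Suc t)" if t: "t < T" and P: "?P t" for t
  proof -
    have int: "integrable M (\<lambda>\<omega>. a\<^sup>2 * (norm (e t \<omega> + v t \<omega>))\<^sup>2)"
      using P by (simp add: square_integrable_norm)
    have si: "square_integrable M (e (Suc t))"
      using t e_sq[OF t] by (intro square_integrable_bound[OF e_meas int]) auto
    have "expectation (\<lambda>\<omega>. (norm (e (Suc t) \<omega>))\<^sup>2) \<le> expectation (\<lambda>\<omega>. a\<^sup>2 * (norm (e t \<omega> + v t \<omega>))\<^sup>2)"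
      by (intro integral_mono square_integrable_norm si int e_sq t)
    also have "\<dots> \<le> a\<^sup>2 * (B / (1 - a)\<^sup>2)"
      using P by (subst integral_mult_right_zero) (intro mult_left_mono, auto)
    finally show ?thesis
      using si by simp
  qed
  have P: "?P t" if "t < T" for t
    using that
  proof (induction t)
    case 0
    have "(1 - a)\<^sup>2 \<le> 1"
      using a by (simp add: power_le_one)
    then have "B \<le> B / (1 - a)\<^sup>2"
      using a B by (simp add: pos_le_divide_eq mult_left_le)
    then show ?case
      using v[OF 0] v_le[OF 0] by (simp add: e_0)
  next
    case (Suc t)
    then have t: "t < T" and P: "?P t"
      by auto
    have si: "square_integrable M (\<lambda>\<omega>. e (Suc t) \<omega> + v (Suc t) \<omega>)"
      using Q_Suc[OF t P] v[OF Suc.prems] by (intro square_integrable_add) auto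
    have le: "(norm (e (Suc t) \<omega> + v (Suc t) \<omega>))\<^sup>2
        \<le> a * (norm (e t \<omega> + v t \<omega>))\<^sup>2 + (norm (v (Suc t) \<omega>))\<^sup>2 / (1 - a)" for \<omega>
    proof -
      have "norm (e (Suc t) \<omega> + v (Suc t) \<omega>) \<le> a * norm (e t \<omega> + v t \<omega>) + norm (v (Suc t) \<omega>)"
        using norm_triangle_ineq[of "e (Suc t) \<omega>" "v (Suc t) \<omega>"] e_Suc[OF t, of \<omega>] by simp
      then have "(norm (e (Suc t) \<omega> + v (Suc t) \<omega>))\<^sup>2
          \<le> (a * norm (e t \<omega> + v t \<omega>) + norm (v (Suc t) \<omega>))\<^sup>2"
        by (intro power_mono) auto
      also have "\<dots> \<le> a * (norm (e t \<omega> + v t \<omega>))\<^sup>2 + (norm (v (Suc t) \<omega>))\<^sup>2 / (1 - a)"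
        by (rule convex_power2_le[OF a])
      finally show ?thesis .
    qed
    have int: "integrable M (\<lambda>\<omega>. a * (norm (e t \<omega> + v t \<omega>))\<^sup>2)"
      "integrable M (\<lambda>\<omega>. (norm (v (Suc t) \<omega>))\<^sup>2 / (1 - a))"
      using P v[OF Suc.prems] by (auto simp: square_integrable_norm)
    have "expectation (\<lambda>\<omega>. (norm (e (Suc t) \<omega> + v (Suc t) \<omega>))\<^sup>2)
        \<le> expectation (\<lambda>\<omega>. a * (norm (e t \<omega> + v t \<omega>))\<^sup>2 + (norm (v (Suc t) \<omega>))\<^sup>2 / (1 - a))"
      by (intro integral_mono square_integrable_norm si Bochner_Integration.integrable_add int le)
    also have "\<dots> = a * expectation (\<lambda>\<omega>. (norm (e t \<omega> + v t \<omega>))\<^sup>2)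
        + expectation (\<lambda>\<omega>. (norm (v (Suc t) \<omega>))\<^sup>2) / (1 - a)"
      using int by simp
    also have "\<dots> \<le> a * (B / (1 - a)\<^sup>2) + B / (1 - a)"
      using P v_le[OF Suc.prems] a by (intro add_mono mult_left_mono divide_right_mono) auto
    \<comment> \<open>\<open>B / (1 - a)\<^sup>2\<close> solves
      \<open>y = a * y + B / (1 - a)\<close>, so the bound reproduces itself.\<close>
    also have "\<dots> = a * (B / (1 - a)\<^sup>2) + (1 - a) * (B / (1 - a)\<^sup>2)"
      using a by (simp add: power2_eq_square)
    also have "\<dots> = B / (1 - a)\<^sup>2"
      by (simp only: distrib_right[symmetric]) simp
    finally show ?case
      using si by simp
  qed
  show "t < T \<Longrightarrow> ?P t"
    by (rule P)
  show "?Q t" if "t \<le> T"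
  proof (cases t)
    case 0
    have "e 0 = (\<lambda>_. 0)" by (auto simp: e_0)
    then show ?thesis
      using 0 B square_integrable_const[of "0::'b"] by simp
  next
    case (Suc s)
    then show ?thesis
      using that P[of s] Q_Suc[of s] by simp
  qed
qed

text \<open>On the left, the summand 1 comes from the worker errors and the quotient from the server
  error; on the right stands the constant of the theorem. Substituting
  \<open>\<delta> = 1 - a\<^sup>2\<close>, the difference of the two numerators over
  \<open>(1 - a)\<^sup>2\<close> is \<open>1 - a\<close> times a polynomial with nonnegative
  coefficients.\<close>

lemma compression_constant_ge:
  fixes \<delta> :: real
  assumes "0 < \<delta>" "\<delta> \<le> 1"
  defines "a \<equiv> sqrt (1 - \<delta>)"
  shows "1 + (1 + a)\<^sup>2 / (1 - a)\<^sup>2 \<le> 2 * (1 + \<delta>) * (2 - \<delta>) / (1 - a)\<^sup>2 + (1 + \<delta>) / \<delta>"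
proof -
  have a: "0 \<le> a" "a < 1" and \<delta>: "\<delta> = 1 - a\<^sup>2"
    using assms by (auto simp: a_def)
  have "2 * (1 + \<delta>) * (2 - \<delta>) - (1 + a)\<^sup>2 = (1 - a) * (3 + a + 2 * a\<^sup>2 + 2 * a ^ 3)"
    by (simp add: \<delta> algebra_simps power2_eq_square power3_eq_cube)
  also have "\<dots> \<ge> 0"
    using a by simp
  finally have "(1 + a)\<^sup>2 / (1 - a)\<^sup>2 \<le> 2 * (1 + \<delta>) * (2 - \<delta>) / (1 - a)\<^sup>2"
    by (intro divide_right_mono) auto
  moreover have "1 \<le> (1 + \<delta>) / \<delta>"
    using assms by simp
  ultimately show ?thesis
    by linarith
qed

section \<open>Runs of SAEF-SGD\<close>

lemma saef_Suc:
  fixes Comp :: "'a::euclidean_space \<Rightarrow> 'a" and G :: "'a \<Rightarrow> 's \<Rightarrow> 'a" and \<eta> K x0 \<zeta>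
  defines "S \<equiv> saef Comp G \<eta> K x0 \<zeta>"
  defines "\<Delta> \<equiv> \<lambda>t k. worker_err (S t) k + \<eta> t *\<^sub>R G (half_model (S t) k) (\<zeta> k t)"
  defines "\<Delta>\<^sub>0 \<equiv> \<lambda>t. server_err (S t) + (1 / real K) *\<^sub>R (\<Sum>k = 1..K. Comp (\<Delta> t k))"
  shows "model (S (Suc t)) = model (S t) - Comp (\<Delta>\<^sub>0 t)"
    and "worker_err (S (Suc t)) k = \<Delta> t k - Comp (\<Delta> t k)"
    and "server_err (S (Suc t)) = \<Delta>\<^sub>0 t - Comp (\<Delta>\<^sub>0 t)"
  by (simp_all add: S_def \<Delta>_def \<Delta>\<^sub>0_def saef_step_def Let_def)

text \<open>The run is adapted: its state at time \<open>t\<close> sees only earlier samples of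
  workers 1 to \<open>K\<close>. Worker errors are compared for these workers only, because the
  record also stores errors for all other indices, driven by other samples.\<close>

lemma saef_cong:
  assumes "\<And>k i. k \<in> {1..K} \<Longrightarrow> i < t \<Longrightarrow> \<zeta> k i = \<zeta>' k i"
  shows "model (saef Comp G \<eta> K x0 \<zeta> t) = model (saef Comp G \<eta> K x0 \<zeta>' t) \<and>
    server_err (saef Comp G \<eta> K x0 \<zeta> t) = server_err (saef Comp G \<eta> K x0 \<zeta>' t) \<and>
    (\<forall>k\<in>{1..K}. worker_err (saef Comp G \<eta> K x0 \<zeta> t) k = worker_err (saef Comp G \<eta> K x0 \<zeta>' t) k)"
  using assms
proof (induction t)
  case (Suc t)
  then have IH: "model (saef Comp G \<eta> K x0 \<zeta> t) = model (saef Comp G \<eta> K x0 \<zeta>' t)"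
    "server_err (saef Comp G \<eta> K x0 \<zeta> t) = server_err (saef Comp G \<eta> K x0 \<zeta>' t)"
    "\<And>k. k \<in> {1..K} \<Longrightarrow> worker_err (saef Comp G \<eta> K x0 \<zeta> t) k = worker_err (saef Comp G \<eta> K x0 \<zeta>' t) k"
    by simp_all
  let ?\<Delta> = "\<lambda>\<zeta> k. worker_err (saef Comp G \<eta> K x0 \<zeta> t) k
    + \<eta> t *\<^sub>R G (half_model (saef Comp G \<eta> K x0 \<zeta> t) k) (\<zeta> k t)"
  have \<Delta>: "?\<Delta> \<zeta> k = ?\<Delta> \<zeta>' k" if "k \<in> {1..K}" for k
    using that IH(3)[OF that] Suc.prems[OF that] by (simp add: half_model_def IH(1))
  then have "(\<Sum>k = 1..K. Comp (?\<Delta> \<zeta> k)) = (\<Sum>k = 1..K. Comp (?\<Delta> \<zeta>' k))"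
    by (intro sum.cong) auto
  then show ?case
    unfolding saef_Suc IH(1,2) using \<Delta> by simp
qed (simp add: saef_init_def)

text \<open>The space \<open>Q\<close> is left general so that the result serves both the
  probability space, with the random samples, and a product space, with its coordinate maps.\<close>

lemma measurable_saef:
  assumes Comp[measurable]: "Comp \<in> borel_measurable borel"
    and G: "(\<lambda>p. G (fst p) (snd p)) \<in> borel_measurable (borel \<Otimes>\<^sub>M N)"
    and \<zeta>: "\<And>k i. k \<in> {1..K} \<Longrightarrow> i < t \<Longrightarrow> \<zeta> k i \<in> measurable Q N"
  shows "(\<lambda>\<omega>. model (saef Comp G \<eta> K x0 (\<lambda>k i. \<zeta> k i \<omega>) t)) \<in> borel_measurable Q \<and>
    (\<lambda>\<omega>. server_err (saef Comp G \<eta> K x0 (\<lambda>k i. \<zeta> k i \<omega>) t)) \<in> borel_measurable Q \<and>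
    (\<forall>k\<in>{1..K}. (\<lambda>\<omega>. worker_err (saef Comp G \<eta> K x0 (\<lambda>k i. \<zeta> k i \<omega>) t) k) \<in> borel_measurable Q)"
  using \<zeta>
proof (induction t)
  case (Suc t)
  let ?S = "\<lambda>\<omega>. saef Comp G \<eta> K x0 (\<lambda>k i. \<zeta> k i \<omega>) t"
  let ?\<Delta> = "\<lambda>k \<omega>. worker_err (?S \<omega>) k + \<eta> t *\<^sub>R G (half_model (?S \<omega>) k) (\<zeta> k t \<omega>)"
  have x[measurable]: "(\<lambda>\<omega>. model (?S \<omega>)) \<in> borel_measurable Q"
    and s[measurable]: "(\<lambda>\<omega>. server_err (?S \<omega>)) \<in> borel_measurable Q"
    and w: "\<And>k. k \<in> {1..K} \<Longrightarrow> (\<lambda>\<omega>. worker_err (?S \<omega>) k) \<in> borel_measurable Q"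
    using Suc by auto
  have \<Delta>: "?\<Delta> k \<in> borel_measurable Q" if k: "k \<in> {1..K}" for k
  proof -
    have [measurable]: "(\<lambda>\<omega>. worker_err (?S \<omega>) k) \<in> borel_measurable Q" "\<zeta> k t \<in> measurable Q N"
      using w k Suc.prems by auto
    have "(\<lambda>\<omega>. (half_model (?S \<omega>) k, \<zeta> k t \<omega>)) \<in> measurable Q (borel \<Otimes>\<^sub>M N)"
      unfolding half_model_def by measurable
    from measurable_compose[OF this G] show ?thesis
      by simp
  qed
  have \<Delta>C: "(\<lambda>\<omega>. Comp (?\<Delta> k \<omega>)) \<in> borel_measurable Q" if "k \<in> {1..K}" for k
    using measurable_compose[OF \<Delta>[OF that] Comp] .
  have [measurable]: "(\<lambda>\<omega>. \<Sum>k = 1..K. Comp (?\<Delta> k \<omega>)) \<in> borel_measurable Q"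
    by (intro borel_measurable_sum \<Delta>C)
  show ?case
    unfolding saef_Suc by (intro conjI ballI borel_measurable_diff \<Delta> \<Delta>C) measurable
qed (simp add: saef_init_def)

text \<open>Every compressed vector occurs twice with opposite signs: \<open>Comp\<close> of the
  server vector in the model and in the server error, \<open>Comp\<close> of the worker vectors in
  the server vector and in the worker errors. Only the uncompressed gradient step survives.\<close>

lemma aux_model_saef_Suc:
  fixes Comp :: "'a::euclidean_space \<Rightarrow> 'a" and G :: "'a \<Rightarrow> 's \<Rightarrow> 'a" and \<eta> K x0 \<zeta>
  defines "S \<equiv> saef Comp G \<eta> K x0 \<zeta>"
  shows "aux_model K (S (Suc t)) = aux_model K (S t)
    - \<eta> t *\<^sub>R ((1 / real K) *\<^sub>R (\<Sum>k = 1..K. G (half_model (S t) k) (\<zeta> k t)))"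
  unfolding aux_model_def S_def saef_Suc
  by (simp add: sum.distrib sum_subtractf scaleR_add_right scaleR_diff_right mult.commute
      flip: scaleR_sum_right)

section \<open>Convergence\<close>

locale saef_sgd = prob_space P
  for P :: "'w measure" +
  fixes D :: "'s measure"
    and f :: "'a::euclidean_space \<Rightarrow> 's \<Rightarrow> real" and F :: "'a \<Rightarrow> real"
    and Comp :: "'a \<Rightarrow> 'a"
    and \<xi> :: "nat \<Rightarrow> nat \<Rightarrow> 'w \<Rightarrow> 's"
    and S :: "nat \<Rightarrow> 'w \<Rightarrow> 'a saef_state"
    and x0 xstar :: 'a
    and K T :: nat
    and \<eta> L \<sigma> M \<delta> :: real
  assumes K: "K \<ge> 1" and T: "T \<ge> 1"
    and indep: "indep_vars (\<lambda>_. D) (\<lambda>(k, t). \<xi> k t) ({1..K} \<times> {..<T})"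
    and law: "\<And>k t. k \<in> {1..K} \<Longrightarrow> t < T \<Longrightarrow> distr P D (\<xi> k t) = D"
    and f_measurable: "\<And>x. f x \<in> borel_measurable D"
    and minimizer: "\<And>x. F xstar \<le> F x"
    and f_diff: "\<And>x s. s \<in> space D \<Longrightarrow> (\<lambda>y. f y s) differentiable (at x)"
    and grad_integrable: "\<And>x. integrable D (stoch_grad f x)"
    and unbiased: "\<And>x. (\<integral>s. stoch_grad f x s \<partial>D) = grad F x"
    and Comp_measurable: "Comp \<in> borel_measurable borel"
    and S_eq: "\<And>t \<omega>. S t \<omega> = saef Comp (stoch_grad f) (\<lambda>_. \<eta>) K x0 (\<lambda>k i. \<xi> k i \<omega>) t"
    and eta: "0 < \<eta>" "\<eta> < 3 / (4 * L)"
    and F_diff: "\<And>x. F differentiable (at x)"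
    and lipschitz: "\<And>x y. norm (grad F x - grad F y) \<le> L * norm (x - y)"
    and variance_half: "\<And>k t. k \<in> {1..K} \<Longrightarrow> t < T \<Longrightarrow>
        expectation_le P (\<lambda>\<omega>. (norm (stoch_grad f (half_model (S t \<omega>) k) (\<xi> k t \<omega>)
          - grad F (half_model (S t \<omega>) k)))\<^sup>2) (\<sigma>\<^sup>2)"
    and bounded_half: "\<And>k t. k \<in> {1..K} \<Longrightarrow> t < T \<Longrightarrow>
        AE \<omega> in P. (norm (grad F (half_model (S t \<omega>) k)))\<^sup>2 \<le> M\<^sup>2"
    and delta: "0 < \<delta>" "\<delta> \<le> 1"
    and compressor: "\<And>v. (norm (Comp v - v))\<^sup>2 \<le> (1 - \<delta>) * (norm v)\<^sup>2"
begin

section \<open>Constants and random processes of the run\<close>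

definition a :: real where "a = sqrt (1 - \<delta>)"

definition B :: real where "B = \<eta>\<^sup>2 * (M\<^sup>2 + \<sigma>\<^sup>2)"

text \<open>Bound on the mean squared worker error plus the squared server error. \<open>B\<close>
  bounds the second moment of a worker's scaled gradient; the server bound is the worker bound times
  \<open>(1 + a)\<^sup>2 / (1 - a)\<^sup>2\<close>, because its inputs are compressed worker
  vectors.\<close>

definition R :: real where "R = a\<^sup>2 * B / (1 - a)\<^sup>2 * (1 + (1 + a)\<^sup>2 / (1 - a)\<^sup>2)"

definition g :: "nat \<Rightarrow> nat \<Rightarrow> 'w \<Rightarrow> 'a" where
  "g t k \<omega> = stoch_grad f (half_model (S t \<omega>) k) (\<xi> k t \<omega>)"

definition m :: "nat \<Rightarrow> nat \<Rightarrow> 'w \<Rightarrow> 'a" where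
  "m t k \<omega> = grad F (half_model (S t \<omega>) k)"

definition noise :: "nat \<Rightarrow> nat \<Rightarrow> 'w \<Rightarrow> 'a" where
  "noise t k \<omega> = g t k \<omega> - m t k \<omega>"

definition \<Delta> :: "nat \<Rightarrow> nat \<Rightarrow> 'w \<Rightarrow> 'a" where
  "\<Delta> t k \<omega> = worker_err (S t \<omega>) k + \<eta> *\<^sub>R g t k \<omega>"

definition z :: "nat \<Rightarrow> 'w \<Rightarrow> 'a" where
  "z t \<omega> = aux_model K (S t \<omega>)"

text \<open>The samples are passed as a function so that the run can be evaluated on the subfamily
  that is independent of a given sample.\<close>

definition run :: "(nat \<times> nat \<Rightarrow> 's) \<Rightarrow> nat \<Rightarrow> 'a saef_state" where
  "run p t = saef Comp (stoch_grad f) (\<lambda>_. \<eta>) K x0 (\<lambda>k i. p (k, i)) t"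

text \<open>The restriction to \<open>A\<close> places the family in the product space over
  \<open>A\<close>; the case expression matches the indexing of \<open>indep\<close>.\<close>

definition samples :: "(nat \<times> nat) set \<Rightarrow> 'w \<Rightarrow> nat \<times> nat \<Rightarrow> 's" where
  "samples A \<omega> = (\<lambda>j\<in>A. (case j of (k, t) \<Rightarrow> \<xi> k t) \<omega>)"

section \<open>Parameter bounds and measurability along the run\<close>

lemma a_bounds: "0 \<le> a" "a < 1" and a_power2: "a\<^sup>2 = 1 - \<delta>"
  using delta by (auto simp: a_def)

lemma B_nonneg: "0 \<le> B"
  by (simp add: B_def)

text \<open>For \<open>L \<le> 0\<close> the bound \<open>3 / (4 * L)\<close> would be at most 0,
  also at \<open>L = 0\<close> since division by zero yields 0, and no positive \<eta> could lie
  below it.\<close>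

lemma L_pos: "0 < L"
  using eta by (smt (verit) divide_nonneg_nonpos)

lemma eta_L: "0 < 3 - 4 * \<eta> * L"
  using eta(2) L_pos by (simp add: field_simps)

lemma xi_measurable[measurable]: "k \<in> {1..K} \<Longrightarrow> t < T \<Longrightarrow> \<xi> k t \<in> measurable P D"
  using indep by (auto simp: indep_vars_def)

text \<open>\<open>D\<close> is the law of the sample of worker 1 at time 0, which exists because
  \<open>K\<close> and \<open>T\<close> are positive.\<close>

lemma prob_space_D: "prob_space D"
  using prob_space_distr[OF xi_measurable[of 1 0]] law[of 1 0] K T by simp

lemma borel_measurable_G:
  "(\<lambda>p. stoch_grad f (fst p) (snd p)) \<in> borel_measurable (borel \<Otimes>\<^sub>M D)"
  by (rule borel_measurable_stoch_grad[OF f_measurable f_diff])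

lemma borel_measurable_grad_F[measurable]: "grad F \<in> borel_measurable borel"
proof (rule borel_measurable_continuous_onI)
  have "L-lipschitz_on UNIV (grad F)"
    using lipschitz L_pos by (auto simp: lipschitz_on_def dist_norm)
  then show "continuous_on UNIV (grad F)"
    by (rule lipschitz_on_continuous_on)
qed

lemma borel_measurable_F[measurable]: "F \<in> borel_measurable borel"
  using F_diff by (intro borel_measurable_continuous_onI)
    (auto simp: continuous_on_eq_continuous_at intro: differentiable_imp_continuous_within)

lemma S_0: "S 0 \<omega> = saef_init x0"
  by (simp add: S_eq)

lemma S_Suc:
  "worker_err (S (Suc t) \<omega>) k = \<Delta> t k \<omega> - Comp (\<Delta> t k \<omega>)"
  "server_err (S (Suc t) \<omega>) = server_err (S t \<omega>) + (1 / real K) *\<^sub>R (\<Sum>k = 1..K. Comp (\<Delta> t k \<omega>))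
     - Comp (server_err (S t \<omega>) + (1 / real K) *\<^sub>R (\<Sum>k = 1..K. Comp (\<Delta> t k \<omega>)))"
  unfolding S_eq \<Delta>_def g_def saef_Suc by simp_all

lemma z_Suc: "z (Suc t) \<omega> = z t \<omega> - \<eta> *\<^sub>R ((1 / real K) *\<^sub>R (\<Sum>k = 1..K. g t k \<omega>))"
  unfolding z_def S_eq aux_model_saef_Suc g_def by simp

lemma
  assumes "t \<le> T"
  shows model_measurable: "(\<lambda>\<omega>. model (S t \<omega>)) \<in> borel_measurable P"
    and server_err_measurable: "(\<lambda>\<omega>. server_err (S t \<omega>)) \<in> borel_measurable P"
    and worker_err_measurable: "k \<in> {1..K} \<Longrightarrow> (\<lambda>\<omega>. worker_err (S t \<omega>) k) \<in> borel_measurable P"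
  using measurable_saef[OF Comp_measurable borel_measurable_G, of K t \<xi> P] xi_measurable assms
  by (auto simp: S_eq)

lemma half_model_measurable:
  "t \<le> T \<Longrightarrow> k \<in> {1..K} \<Longrightarrow> (\<lambda>\<omega>. half_model (S t \<omega>) k) \<in> borel_measurable P"
  unfolding half_model_def
  by (intro borel_measurable_diff model_measurable worker_err_measurable)

lemma z_measurable: "t \<le> T \<Longrightarrow> z t \<in> borel_measurable P"
  unfolding z_def aux_model_def
  by (intro borel_measurable_diff borel_measurable_add borel_measurable_scaleR borel_measurable_const
      borel_measurable_sum model_measurable worker_err_measurable server_err_measurable)

lemma m_measurable: "t < T \<Longrightarrow> k \<in> {1..K} \<Longrightarrow> m t k \<in> borel_measurable P"
  unfolding m_def
  by (intro measurable_compose[OF half_model_measurable borel_measurable_grad_F]) auto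

lemma g_measurable:
  assumes "t < T" "k \<in> {1..K}"
  shows "g t k \<in> borel_measurable P"
proof -
  have "(\<lambda>\<omega>. (half_model (S t \<omega>) k, \<xi> k t \<omega>)) \<in> measurable P (borel \<Otimes>\<^sub>M D)"
    using assms by (intro measurable_Pair half_model_measurable xi_measurable) auto
  from measurable_compose[OF this borel_measurable_G] show ?thesis
    by (simp add: g_def[abs_def])
qed

section \<open>Second moments of gradients and noise\<close>

lemma
  assumes "t < T" "k \<in> {1..K}"
  shows square_integrable_m: "square_integrable P (m t k)"
    and expectation_m_le: "expectation (\<lambda>\<omega>. (norm (m t k \<omega>))\<^sup>2) \<le> M\<^sup>2"
proof -
  have le: "AE \<omega> in P. (norm (m t k \<omega>))\<^sup>2 \<le> M\<^sup>2"
    unfolding m_def using assms by (intro bounded_half)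
  show si: "square_integrable P (m t k)"
    using assms le by (intro square_integrable_bound[where Y = "\<lambda>_. M\<^sup>2"] m_measurable) auto
  have "expectation (\<lambda>\<omega>. (norm (m t k \<omega>))\<^sup>2) \<le> expectation (\<lambda>_. M\<^sup>2)"
    using le by (intro integral_mono_AE square_integrable_norm si) auto
  then show "expectation (\<lambda>\<omega>. (norm (m t k \<omega>))\<^sup>2) \<le> M\<^sup>2"
    by (simp add: prob_space)
qed

lemma
  assumes "t < T" "k \<in> {1..K}"
  shows square_integrable_noise: "square_integrable P (noise t k)"
    and expectation_noise_le: "expectation (\<lambda>\<omega>. (norm (noise t k \<omega>))\<^sup>2) \<le> \<sigma>\<^sup>2"
  using variance_half[OF assms(2,1)] g_measurable[OF assms] m_measurable[OF assms]
  by (auto simp: square_integrable_def expectation_le_def noise_def[abs_def] g_def[abs_def] m_def[abs_def])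

section \<open>Orthogonality of the noise to the past and across workers\<close>

text \<open>Outside \<open>A\<close> the restricted family is \<open>undefined\<close>, but by
  \<open>saef_cong\<close> the run up to time \<open>t\<close> never looks there when
  \<open>A\<close> contains all samples before \<open>t\<close>.\<close>

lemma run_samples:
  assumes A: "{1..K} \<times> {..<t} \<subseteq> A"
  shows "aux_model K (run (samples A \<omega>) t) = z t \<omega>"
    and "k \<in> {1..K} \<Longrightarrow> half_model (run (samples A \<omega>) t) k = half_model (S t \<omega>) k"
proof -
  have "samples A \<omega> (k, i) = \<xi> k i \<omega>" if "k \<in> {1..K}" "i < t" for k i
    using that subsetD[OF A, of "(k, i)"] by (simp add: samples_def)
  note cong = saef_cong[where \<zeta> = "\<lambda>k i. samples A \<omega> (k, i)" and K = K and t = t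
      and Comp = Comp and G = "stoch_grad f" and \<eta> = "\<lambda>_. \<eta>" and ?x0.0 = x0, OF this]
  have *: "model (run (samples A \<omega>) t) = model (S t \<omega>)"
    "server_err (run (samples A \<omega>) t) = server_err (S t \<omega>)"
    "\<And>k. k \<in> {1..K} \<Longrightarrow> worker_err (run (samples A \<omega>) t) k = worker_err (S t \<omega>) k"
    using cong by (simp_all add: run_def S_eq)
  show "aux_model K (run (samples A \<omega>) t) = z t \<omega>"
    unfolding aux_model_def z_def *(1,2) using *(3) by simp
  show "half_model (run (samples A \<omega>) t) k = half_model (S t \<omega>) k" if "k \<in> {1..K}"
    unfolding half_model_def using * that by simp
qed

lemma
  assumes A: "{1..K} \<times> {..<t} \<subseteq> A"
  shows aux_model_run_measurable:
      "(\<lambda>p. aux_model K (run p t)) \<in> borel_measurable (PiM A (\<lambda>_. D))"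
    and half_model_run_measurable:
      "k \<in> {1..K} \<Longrightarrow> (\<lambda>p. half_model (run p t) k) \<in> borel_measurable (PiM A (\<lambda>_. D))"
proof -
  have proj: "(\<lambda>p. p (k, i)) \<in> measurable (PiM A (\<lambda>_. D)) D" if "k \<in> {1..K}" "i < t" for k i
    using that by (intro measurable_component_singleton subsetD[OF A]) auto
  have *: "(\<lambda>p. model (run p t)) \<in> borel_measurable (PiM A (\<lambda>_. D))"
    "(\<lambda>p. server_err (run p t)) \<in> borel_measurable (PiM A (\<lambda>_. D))"
    "\<And>k. k \<in> {1..K} \<Longrightarrow> (\<lambda>p. worker_err (run p t) k) \<in> borel_measurable (PiM A (\<lambda>_. D))"
    using measurable_saef[where \<zeta> = "\<lambda>k i p. p (k, i)" and \<eta> = "\<lambda>_. \<eta>" and K = K and t = t,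
        OF Comp_measurable borel_measurable_G proj]
    by (simp_all add: run_def)
  show "(\<lambda>p. aux_model K (run p t)) \<in> borel_measurable (PiM A (\<lambda>_. D))"
    unfolding aux_model_def
    by (intro borel_measurable_diff borel_measurable_add borel_measurable_scaleR borel_measurable_const
        borel_measurable_sum *)
  show "(\<lambda>p. half_model (run p t) k) \<in> borel_measurable (PiM A (\<lambda>_. D))" if "k \<in> {1..K}"
    unfolding half_model_def using that by (intro borel_measurable_diff *)
qed

text \<open>Once the samples in \<open>A\<close> are fixed, the step-ahead model is a fixed point of
  space, and unbiasedness there makes the integral over the fresh sample vanish. \<open>A\<close>
  may also contain samples of other workers at time \<open>t\<close>, which orthogonality between
  workers requires.\<close>

lemma expectation_inner_noise:
  assumes t: "t < T" and k: "k \<in> {1..K}"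
    and A: "{1..K} \<times> {..<t} \<subseteq> A" "A \<subseteq> {1..K} \<times> {..<T}" "(k, t) \<notin> A"
    and v: "v \<in> borel_measurable (PiM A (\<lambda>_. D))"
    and si: "square_integrable P (\<lambda>\<omega>. v (samples A \<omega>))"
  shows "expectation (\<lambda>\<omega>. inner (v (samples A \<omega>)) (noise t k \<omega>)) = 0"
proof -
  interpret D: prob_space D by (rule prob_space_D)
  let ?H = "\<lambda>p. half_model (run p t) k"
  let ?h = "\<lambda>(p, s). inner (v p) (stoch_grad f (?H p) s - grad F (?H p))"
  note [measurable] = half_model_run_measurable[OF A(1) k] v
  have "(\<lambda>q. (?H (fst q), snd q)) \<in> measurable (PiM A (\<lambda>_. D) \<Otimes>\<^sub>M D) (borel \<Otimes>\<^sub>M D)"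
    by measurable
  from measurable_compose[OF this borel_measurable_G]
  have [measurable]: "(\<lambda>q. stoch_grad f (?H (fst q)) (snd q)) \<in> borel_measurable (PiM A (\<lambda>_. D) \<Otimes>\<^sub>M D)"
    by simp
  have h: "?h \<in> borel_measurable (PiM A (\<lambda>_. D) \<Otimes>\<^sub>M D)"
    unfolding case_prod_beta by measurable
  have eq: "?h (samples A \<omega>, \<xi> k t \<omega>) = inner (v (samples A \<omega>)) (noise t k \<omega>)" for \<omega>
    using run_samples(2)[OF A(1) k] by (simp add: noise_def g_def m_def)
  have zero: "(\<integral>s. ?h (p, s) \<partial>D) = 0" for p
  proof -
    have "(\<integral>s. ?h (p, s) \<partial>D) = inner (v p) (\<integral>s. stoch_grad f (?H p) s - grad F (?H p) \<partial>D)"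
      using grad_integrable by simp
    also have "\<dots> = 0"
      using grad_integrable by (simp add: unbiased D.prob_space)
    finally show ?thesis .
  qed
  have "expectation (\<lambda>\<omega>. ?h (\<lambda>j\<in>A. (case j of (k, t) \<Rightarrow> \<xi> k t) \<omega>, (case (k, t) of (k, t) \<Rightarrow> \<xi> k t) \<omega>)) = 0"
  proof (rule integral_indep_vars_eq_0[OF indep A(2) _ A(3) h])
    show "integrable P (\<lambda>\<omega>. ?h (\<lambda>j\<in>A. (case j of (k, t) \<Rightarrow> \<xi> k t) \<omega>, (case (k, t) of (k, t) \<Rightarrow> \<xi> k t) \<omega>))"
      using integrable_inner_square_integrable[OF si square_integrable_noise[OF t k]] eq
      by (simp add: samples_def)
  qed (use t k zero law in auto)
  then show ?thesis
    using eq by (simp add: samples_def)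
qed

lemma expectation_inner_m_noise:
  assumes t: "t < T" and j: "j \<in> {1..K}" and k: "k \<in> {1..K}"
  shows "expectation (\<lambda>\<omega>. inner (m t j \<omega>) (noise t k \<omega>)) = 0"
proof -
  let ?A = "{1..K} \<times> {..<t}" and ?v = "\<lambda>p. grad F (half_model (run p t) j)"
  have eq: "?v (samples ?A \<omega>) = m t j \<omega>" for \<omega>
    using run_samples(2)[OF order_refl j] by (simp add: m_def)
  have v: "?v \<in> borel_measurable (PiM ?A (\<lambda>_. D))"
    using j by (intro measurable_compose[OF half_model_run_measurable borel_measurable_grad_F]) auto
  have si: "square_integrable P (\<lambda>\<omega>. ?v (samples ?A \<omega>))"
    unfolding eq by (rule square_integrable_m[OF t j])
  have "expectation (\<lambda>\<omega>. inner (?v (samples ?A \<omega>)) (noise t k \<omega>)) = 0"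
    using t by (intro expectation_inner_noise[OF t k _ _ _ v si]) auto
  then show ?thesis
    unfolding eq .
qed

text \<open>The noise of worker \<open>j\<close> is a function of the past and the sample
  \<open>(j, t)\<close>, so \<open>A\<close> is the past enlarged by this pair;
  \<open>j \<noteq> k\<close> keeps \<open>(k, t)\<close> fresh.\<close>

lemma expectation_inner_noise_noise:
  assumes t: "t < T" and j: "j \<in> {1..K}" and k: "k \<in> {1..K}" and "j \<noteq> k"
  shows "expectation (\<lambda>\<omega>. inner (noise t j \<omega>) (noise t k \<omega>)) = 0"
proof -
  let ?A = "insert (j, t) ({1..K} \<times> {..<t})" and ?H = "\<lambda>p. half_model (run p t) j"
  let ?v = "\<lambda>p. stoch_grad f (?H p) (p (j, t)) - grad F (?H p)"
  have A: "{1..K} \<times> {..<t} \<subseteq> ?A" by auto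
  have eq: "?v (samples ?A \<omega>) = noise t j \<omega>" for \<omega>
    using run_samples(2)[OF A j] by (simp add: noise_def g_def m_def samples_def)
  have [measurable]: "?H \<in> borel_measurable (PiM ?A (\<lambda>_. D))"
    by (rule half_model_run_measurable[OF A j])
  have "(\<lambda>p. (?H p, p (j, t))) \<in> measurable (PiM ?A (\<lambda>_. D)) (borel \<Otimes>\<^sub>M D)"
    by measurable
  from measurable_compose[OF this borel_measurable_G]
  have v: "?v \<in> borel_measurable (PiM ?A (\<lambda>_. D))"
    by (intro borel_measurable_diff measurable_compose[OF \<open>?H \<in> _\<close> borel_measurable_grad_F]) simp
  have si: "square_integrable P (\<lambda>\<omega>. ?v (samples ?A \<omega>))"
    unfolding eq by (rule square_integrable_noise[OF t j])
  have "expectation (\<lambda>\<omega>. inner (?v (samples ?A \<omega>)) (noise t k \<omega>)) = 0"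
    using t j \<open>j \<noteq> k\<close> by (intro expectation_inner_noise[OF t k A _ _ v si]) auto
  then show ?thesis
    unfolding eq .
qed

lemma g_eq: "g t k \<omega> = m t k \<omega> + noise t k \<omega>"
  by (simp add: noise_def)

text \<open>Pythagoras: the noise is orthogonal to the true gradient \<open>m\<close>, so the two
  second moments add without a factor 2.\<close>

lemma
  assumes t: "t < T" and k: "k \<in> {1..K}"
  shows square_integrable_g: "square_integrable P (g t k)"
    and expectation_g_le: "expectation (\<lambda>\<omega>. (norm (g t k \<omega>))\<^sup>2) \<le> M\<^sup>2 + \<sigma>\<^sup>2"
proof -
  note m = square_integrable_m[OF t k] and n = square_integrable_noise[OF t k]
  show "square_integrable P (g t k)"
    using square_integrable_add[OF m n] by (simp add: noise_def)
  have eq: "(norm (g t k \<omega>))\<^sup>2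
      = (norm (m t k \<omega>))\<^sup>2 + 2 * inner (m t k \<omega>) (noise t k \<omega>) + (norm (noise t k \<omega>))\<^sup>2" for \<omega>
    unfolding g_eq by (simp add: power2_norm_eq_inner inner_commute algebra_simps)
  show "expectation (\<lambda>\<omega>. (norm (g t k \<omega>))\<^sup>2) \<le> M\<^sup>2 + \<sigma>\<^sup>2"
    unfolding eq
    using square_integrable_norm[OF m] square_integrable_norm[OF n]
      integrable_inner_square_integrable[OF m n] expectation_inner_m_noise[OF t k k]
      expectation_m_le[OF t k] expectation_noise_le[OF t k]
    by simp
qed

section \<open>Second moments of the worker and server errors\<close>

lemma norm_compression_error: "norm (v - Comp v) \<le> a * norm v"
proof (rule power2_le_imp_le)
  show "(norm (v - Comp v))\<^sup>2 \<le> (a * norm v)\<^sup>2"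
    using compressor[of v] by (simp add: power_mult_distrib a_power2 norm_minus_commute)
qed (use a_bounds in auto)

lemma norm_Comp: "norm (Comp v) \<le> (1 + a) * norm v"
proof -
  have "norm (Comp v) \<le> norm v + norm (v - Comp v)"
    by (metis norm_minus_commute norm_triangle_sub)
  then show ?thesis
    using norm_compression_error[of v] by (simp add: algebra_simps)
qed

text \<open>\<open>error_feedback\<close> with input \<open>\<eta> *\<^sub>R g t k\<close> and bound
  \<open>B\<close>. The bound on \<open>\<Delta>\<close> controls what the server receives; the
  bound on the error enters the distance between step-ahead models and the auxiliary
  variable.\<close>

lemma
  assumes k: "k \<in> {1..K}"
  shows \<Delta>_bound: "t < T \<Longrightarrow> square_integrable P (\<Delta> t k) \<and>
      expectation (\<lambda>\<omega>. (norm (\<Delta> t k \<omega>))\<^sup>2) \<le> B / (1 - a)\<^sup>2"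
    and worker_err_bound: "t \<le> T \<Longrightarrow> square_integrable P (\<lambda>\<omega>. worker_err (S t \<omega>) k) \<and>
      expectation (\<lambda>\<omega>. (norm (worker_err (S t \<omega>) k))\<^sup>2) \<le> a\<^sup>2 * B / (1 - a)\<^sup>2"
proof -
  let ?e = "\<lambda>t \<omega>. worker_err (S t \<omega>) k" and ?v = "\<lambda>t \<omega>. \<eta> *\<^sub>R g t k \<omega>"
  have v: "square_integrable P (?v t)" if "t < T" for t
    using square_integrable_g[OF that k] by (rule square_integrable_scaleR)
  have v_le: "expectation (\<lambda>\<omega>. (norm (?v t \<omega>))\<^sup>2) \<le> B" if "t < T" for t
    using expectation_g_le[OF that k] by (simp add: power_mult_distrib B_def mult_left_mono)
  have e_0: "?e 0 \<omega> = 0" for \<omega>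
    by (simp add: S_0 saef_init_def)
  have e_Suc: "norm (?e (Suc t) \<omega>) \<le> a * norm (?e t \<omega> + ?v t \<omega>)" for t \<omega>
    using norm_compression_error[of "\<Delta> t k \<omega>"] by (simp add: S_Suc \<Delta>_def)
  note * = a_bounds B_nonneg e_0 e_Suc worker_err_measurable[OF _ k] v v_le
  show "t < T \<Longrightarrow> square_integrable P (\<Delta> t k) \<and>
      expectation (\<lambda>\<omega>. (norm (\<Delta> t k \<omega>))\<^sup>2) \<le> B / (1 - a)\<^sup>2"
    using error_feedback_step[where e = ?e and v = ?v and T = T, OF *] by (simp add: \<Delta>_def[abs_def])
  show "t \<le> T \<Longrightarrow> square_integrable P (?e t) \<and>
      expectation (\<lambda>\<omega>. (norm (?e t \<omega>))\<^sup>2) \<le> a\<^sup>2 * B / (1 - a)\<^sup>2"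
    using error_feedback_error[where e = ?e and v = ?v and T = T, OF *] by simp
qed

text \<open>\<open>error_feedback\<close> again, now with the mean of the compressed worker vectors
  as input. \<open>norm_Comp\<close> costs the factor \<open>(1 + a)\<^sup>2\<close> over the bound
  on \<open>\<Delta>\<close>, and averaging over workers costs nothing by convexity of the squared
  norm.\<close>

lemma server_err_bound:
  assumes "t \<le> T"
  shows "square_integrable P (\<lambda>\<omega>. server_err (S t \<omega>)) \<and>
    expectation (\<lambda>\<omega>. (norm (server_err (S t \<omega>)))\<^sup>2) \<le> a\<^sup>2 * ((1 + a)\<^sup>2 * (B / (1 - a)\<^sup>2)) / (1 - a)\<^sup>2"
proof -
  let ?e = "\<lambda>t \<omega>. server_err (S t \<omega>)"
  let ?v = "\<lambda>t \<omega>. (1 / real K) *\<^sub>R (\<Sum>k = 1..K. Comp (\<Delta> t k \<omega>))"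
  have C_sq: "(norm (Comp u))\<^sup>2 \<le> (1 + a)\<^sup>2 * (norm u)\<^sup>2" for u
    using power_mono[OF norm_Comp norm_ge_zero, of u 2] by (simp add: power_mult_distrib)
  have C: "square_integrable P (\<lambda>\<omega>. Comp (\<Delta> t k \<omega>))"
    "expectation (\<lambda>\<omega>. (norm (Comp (\<Delta> t k \<omega>)))\<^sup>2) \<le> (1 + a)\<^sup>2 * (B / (1 - a)\<^sup>2)"
    if t: "t < T" and k: "k \<in> {1..K}" for t k
  proof -
    note \<Delta> = \<Delta>_bound[OF k t]
    have int: "integrable P (\<lambda>\<omega>. (1 + a)\<^sup>2 * (norm (\<Delta> t k \<omega>))\<^sup>2)"
      using \<Delta> by (simp add: square_integrable_norm)
    have "(\<lambda>\<omega>. Comp (\<Delta> t k \<omega>)) \<in> borel_measurable P"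
      using \<Delta> by (intro measurable_compose[OF _ Comp_measurable]) (simp add: square_integrable_measurable)
    then show si: "square_integrable P (\<lambda>\<omega>. Comp (\<Delta> t k \<omega>))"
      using C_sq by (intro square_integrable_bound[OF _ int]) auto
    have "expectation (\<lambda>\<omega>. (norm (Comp (\<Delta> t k \<omega>)))\<^sup>2) \<le> expectation (\<lambda>\<omega>. (1 + a)\<^sup>2 * (norm (\<Delta> t k \<omega>))\<^sup>2)"
      by (intro integral_mono square_integrable_norm si int C_sq)
    also have "\<dots> \<le> (1 + a)\<^sup>2 * (B / (1 - a)\<^sup>2)"
      using \<Delta> by (subst integral_mult_right_zero) (intro mult_left_mono, auto)
    finally show "expectation (\<lambda>\<omega>. (norm (Comp (\<Delta> t k \<omega>)))\<^sup>2) \<le> (1 + a)\<^sup>2 * (B / (1 - a)\<^sup>2)" .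
  qed
  have v: "square_integrable P (?v t)" if "t < T" for t
    using C(1)[OF that] by (intro square_integrable_scaleR square_integrable_sum)
  have v_le: "expectation (\<lambda>\<omega>. (norm (?v t \<omega>))\<^sup>2) \<le> (1 + a)\<^sup>2 * (B / (1 - a)\<^sup>2)" if t: "t < T" for t
  proof -
    have int: "integrable P (\<lambda>\<omega>. (1 / real K) * (\<Sum>k = 1..K. (norm (Comp (\<Delta> t k \<omega>)))\<^sup>2))"
      using C(1)[OF t] by (intro integrable_mult_right Bochner_Integration.integrable_sum square_integrable_norm)
    have le: "(norm (?v t \<omega>))\<^sup>2 \<le> (1 / real K) * (\<Sum>k = 1..K. (norm (Comp (\<Delta> t k \<omega>)))\<^sup>2)" for \<omega>
      using norm_mean_power2_le[where I = "{1..K}" and u = "\<lambda>k. Comp (\<Delta> t k \<omega>)"] by simp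
    have "expectation (\<lambda>\<omega>. (norm (?v t \<omega>))\<^sup>2)
        \<le> expectation (\<lambda>\<omega>. (1 / real K) * (\<Sum>k = 1..K. (norm (Comp (\<Delta> t k \<omega>)))\<^sup>2))"
      by (intro integral_mono square_integrable_norm v t int le)
    also have "\<dots> = (1 / real K) * (\<Sum>k = 1..K. expectation (\<lambda>\<omega>. (norm (Comp (\<Delta> t k \<omega>)))\<^sup>2))"
      using C(1)[OF t] by (subst integral_mult_right_zero, subst Bochner_Integration.integral_sum)
        (auto simp: square_integrable_norm)
    also have "\<dots> \<le> (1 / real K) * (\<Sum>k = 1..K. (1 + a)\<^sup>2 * (B / (1 - a)\<^sup>2))"
      using C(2)[OF t] by (intro mult_left_mono sum_mono) auto
    also have "\<dots> = (1 + a)\<^sup>2 * (B / (1 - a)\<^sup>2)"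
      using K by simp
    finally show ?thesis .
  qed
  have e_0: "?e 0 \<omega> = 0" for \<omega>
    by (simp add: S_0 saef_init_def)
  have e_Suc: "norm (?e (Suc t) \<omega>) \<le> a * norm (?e t \<omega> + ?v t \<omega>)" for t \<omega>
    unfolding S_Suc(2) by (rule norm_compression_error)
  have nonneg: "0 \<le> (1 + a)\<^sup>2 * (B / (1 - a)\<^sup>2)"
    using B_nonneg by simp
  show ?thesis
    using error_feedback_error[where e = ?e and v = ?v and T = T,
      OF a_bounds nonneg e_0 e_Suc server_err_measurable v v_le assms] .
qed

section \<open>Integrability along the auxiliary sequence\<close>

lemma square_integrable_z: "t \<le> T \<Longrightarrow> square_integrable P (z t)"
proof (induction t)
  case 0
  have "z 0 = (\<lambda>_. aux_model K (saef_init x0))"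
    by (auto simp: z_def S_0)
  then show ?case
    by (simp add: square_integrable_const)
next
  case (Suc t)
  have "z (Suc t) = (\<lambda>\<omega>. z t \<omega> - \<eta> *\<^sub>R ((1 / real K) *\<^sub>R (\<Sum>k = 1..K. g t k \<omega>)))"
    by (auto simp: z_Suc)
  then show ?case
    using Suc by (auto intro!: square_integrable_diff square_integrable_scaleR square_integrable_sum square_integrable_g)
qed

text \<open>The gradient bound is assumed at step-ahead models, not at \<open>z t\<close>. Here the
  Lipschitz condition gives linear growth away from \<open>x0\<close>, and \<open>z t\<close> is
  square-integrable.\<close>

lemma square_integrable_grad_z:
  assumes "t \<le> T"
  shows "square_integrable P (\<lambda>\<omega>. grad F (z t \<omega>))"
proof (rule square_integrable_bound)
  have "square_integrable P (\<lambda>\<omega>. z t \<omega> - x0)"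
    using assms by (intro square_integrable_diff square_integrable_z square_integrable_const)
  then show "integrable P (\<lambda>\<omega>. 2 * (norm (grad F x0))\<^sup>2 + 2 * (L\<^sup>2 * (norm (z t \<omega> - x0))\<^sup>2))"
    by (simp add: square_integrable_norm)
  have "(norm (grad F x))\<^sup>2 \<le> 2 * (norm (grad F x0))\<^sup>2 + 2 * (L\<^sup>2 * (norm (x - x0))\<^sup>2)" for x
  proof -
    have "(norm (grad F x))\<^sup>2 \<le> 2 * (norm (grad F x0))\<^sup>2 + 2 * (norm (grad F x - grad F x0))\<^sup>2"
      using norm_add_power2_le[of "grad F x0" "grad F x - grad F x0"] by simp
    also have "(norm (grad F x - grad F x0))\<^sup>2 \<le> L\<^sup>2 * (norm (x - x0))\<^sup>2"
      using power_mono[OF lipschitz[of x x0], of 2] by (simp add: power_mult_distrib)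
    finally show ?thesis by simp
  qed
  then show "AE \<omega> in P. (norm (grad F (z t \<omega>)))\<^sup>2
      \<le> 2 * (norm (grad F x0))\<^sup>2 + 2 * (L\<^sup>2 * (norm (z t \<omega> - x0))\<^sup>2)"
    by simp
  show "(\<lambda>\<omega>. grad F (z t \<omega>)) \<in> borel_measurable P"
    using assms by (intro measurable_compose[OF z_measurable borel_measurable_grad_F])
qed

text \<open>\<open>F\<close> lies between its minimum and the quadratic that the descent lemma gives
  at \<open>x0\<close>; both are integrable along \<open>z t\<close>.\<close>

lemma integrable_F_z:
  assumes "t \<le> T"
  shows "integrable P (\<lambda>\<omega>. F (z t \<omega>))"
proof -
  let ?U = "\<lambda>x. F x0 + inner (grad F x0) (x - x0) + L / 2 * (norm (x - x0))\<^sup>2"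
  have si: "square_integrable P (\<lambda>\<omega>. z t \<omega> - x0)"
    using assms by (intro square_integrable_diff square_integrable_z square_integrable_const)
  show ?thesis
  proof (rule Bochner_Integration.integrable_bound)
    show "integrable P (\<lambda>\<omega>. \<bar>F xstar\<bar> + \<bar>?U (z t \<omega>)\<bar>)"
      using square_integrable_norm[OF si]
        integrable_inner_square_integrable[OF square_integrable_const[of "grad F x0"] si]
      by (intro Bochner_Integration.integrable_add integrable_abs) auto
    show "(\<lambda>\<omega>. F (z t \<omega>)) \<in> borel_measurable P"
      using assms by (intro measurable_compose[OF z_measurable borel_measurable_F])
    have "\<bar>F x\<bar> \<le> \<bar>F xstar\<bar> + \<bar>?U x\<bar>" for x
      using minimizer[of x] descent_lemma[OF F_diff lipschitz, of x x0] by linarith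
    then show "AE \<omega> in P. norm (F (z t \<omega>)) \<le> norm (\<bar>F xstar\<bar> + \<bar>?U (z t \<omega>)\<bar>)"
      by auto
  qed
qed

lemma expectation_inner_grad_z_noise:
  assumes t: "t < T" and k: "k \<in> {1..K}"
  shows "expectation (\<lambda>\<omega>. inner (grad F (z t \<omega>)) (noise t k \<omega>)) = 0"
proof -
  let ?A = "{1..K} \<times> {..<t}" and ?v = "\<lambda>p. grad F (aux_model K (run p t))"
  have eq: "?v (samples ?A \<omega>) = grad F (z t \<omega>)" for \<omega>
    using run_samples(1)[OF order_refl] by simp
  have v: "?v \<in> borel_measurable (PiM ?A (\<lambda>_. D))"
    by (intro measurable_compose[OF aux_model_run_measurable borel_measurable_grad_F]) auto
  have si: "square_integrable P (\<lambda>\<omega>. ?v (samples ?A \<omega>))"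
    unfolding eq using t by (intro square_integrable_grad_z) simp
  have "expectation (\<lambda>\<omega>. inner (?v (samples ?A \<omega>)) (noise t k \<omega>)) = 0"
    using t by (intro expectation_inner_noise[OF t k _ _ _ v si]) auto
  then show ?thesis
    unfolding eq .
qed

section \<open>Mean gradient, mean noise and their distance from the gradient at the auxiliary
  variable\<close>

definition mean_m :: "nat \<Rightarrow> 'w \<Rightarrow> 'a" where
  "mean_m t \<omega> = (1 / real K) *\<^sub>R (\<Sum>k = 1..K. m t k \<omega>)"

definition mean_noise :: "nat \<Rightarrow> 'w \<Rightarrow> 'a" where
  "mean_noise t \<omega> = (1 / real K) *\<^sub>R (\<Sum>k = 1..K. noise t k \<omega>)"

lemma square_integrable_mean_m: "t < T \<Longrightarrow> square_integrable P (mean_m t)"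
  unfolding mean_m_def
  by (intro square_integrable_scaleR square_integrable_sum square_integrable_m)

lemma square_integrable_mean_noise: "t < T \<Longrightarrow> square_integrable P (mean_noise t)"
  unfolding mean_noise_def
  by (intro square_integrable_scaleR square_integrable_sum square_integrable_noise)

lemma z_Suc_mean: "z (Suc t) \<omega> = z t \<omega> - \<eta> *\<^sub>R (mean_m t \<omega> + mean_noise t \<omega>)"
  by (simp add: z_Suc mean_m_def mean_noise_def g_eq sum.distrib scaleR_add_right)

lemma expectation_inner_mean_noise:
  assumes t: "t < T" and X: "square_integrable P X"
    and orth: "\<And>k. k \<in> {1..K} \<Longrightarrow> expectation (\<lambda>\<omega>. inner (X \<omega>) (noise t k \<omega>)) = 0"
  shows "expectation (\<lambda>\<omega>. inner (X \<omega>) (mean_noise t \<omega>)) = 0"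
proof -
  have "expectation (\<lambda>\<omega>. inner (X \<omega>) (mean_noise t \<omega>))
      = (1 / real K) * expectation (\<lambda>\<omega>. \<Sum>k = 1..K. inner (X \<omega>) (noise t k \<omega>))"
    by (simp add: mean_noise_def inner_sum_right)
  also have "expectation (\<lambda>\<omega>. \<Sum>k = 1..K. inner (X \<omega>) (noise t k \<omega>))
      = (\<Sum>k = 1..K. expectation (\<lambda>\<omega>. inner (X \<omega>) (noise t k \<omega>)))"
    by (intro Bochner_Integration.integral_sum integrable_inner_square_integrable X square_integrable_noise t)
  also have "\<dots> = 0"
    using orth by simp
  finally show ?thesis
    by simp
qed

lemma expectation_inner_grad_z_mean_noise:
  assumes t: "t < T"
  shows "expectation (\<lambda>\<omega>. inner (grad F (z t \<omega>)) (mean_noise t \<omega>)) = 0"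
  using t by (intro expectation_inner_mean_noise square_integrable_grad_z expectation_inner_grad_z_noise) auto

lemma expectation_inner_mean_m_mean_noise:
  assumes t: "t < T"
  shows "expectation (\<lambda>\<omega>. inner (mean_m t \<omega>) (mean_noise t \<omega>)) = 0"
proof (intro expectation_inner_mean_noise square_integrable_mean_m t)
  fix k assume k: "k \<in> {1..K}"
  have "expectation (\<lambda>\<omega>. inner (mean_m t \<omega>) (noise t k \<omega>))
      = (1 / real K) * expectation (\<lambda>\<omega>. \<Sum>j = 1..K. inner (m t j \<omega>) (noise t k \<omega>))"
    by (simp add: mean_m_def inner_sum_left)
  also have "expectation (\<lambda>\<omega>. \<Sum>j = 1..K. inner (m t j \<omega>) (noise t k \<omega>))
      = (\<Sum>j = 1..K. expectation (\<lambda>\<omega>. inner (m t j \<omega>) (noise t k \<omega>)))"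
    using t k
    by (intro Bochner_Integration.integral_sum integrable_inner_square_integrable square_integrable_m square_integrable_noise)
  also have "\<dots> = 0"
    using expectation_inner_m_noise[OF t _ k] by simp
  finally show "expectation (\<lambda>\<omega>. inner (mean_m t \<omega>) (noise t k \<omega>)) = 0"
    by simp
qed

text \<open>Of the \<open>K\<^sup>2\<close> inner products in the expanded square, only the
  \<open>K\<close> diagonal ones have an expectation that can differ from 0. Against the prefactor
  \<open>(1 / K)\<^sup>2\<close> this yields the gain of \<open>1 / K\<close>.\<close>

lemma expectation_mean_noise_le:
  assumes t: "t < T"
  shows "expectation (\<lambda>\<omega>. (norm (mean_noise t \<omega>))\<^sup>2) \<le> \<sigma>\<^sup>2 / real K"
proof -
  have eq: "(norm (mean_noise t \<omega>))\<^sup>2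
      = (1 / real K)\<^sup>2 * (\<Sum>j = 1..K. \<Sum>k = 1..K. inner (noise t j \<omega>) (noise t k \<omega>))" for \<omega>
    by (simp add: mean_noise_def power_mult_distrib power2_norm_eq_inner[of "sum _ _"]
        inner_sum_left inner_sum_right power_divide) (intro disjI2 sum.swap)
  have int: "integrable P (\<lambda>\<omega>. inner (noise t j \<omega>) (noise t k \<omega>))" if "j \<in> {1..K}" "k \<in> {1..K}" for j k
    using that t by (intro integrable_inner_square_integrable square_integrable_noise)
  have "expectation (\<lambda>\<omega>. (norm (mean_noise t \<omega>))\<^sup>2)
      = (1 / real K)\<^sup>2 * expectation (\<lambda>\<omega>. \<Sum>j = 1..K. \<Sum>k = 1..K. inner (noise t j \<omega>) (noise t k \<omega>))"
    unfolding eq by (rule integral_mult_right_zero)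
  also have "expectation (\<lambda>\<omega>. \<Sum>j = 1..K. \<Sum>k = 1..K. inner (noise t j \<omega>) (noise t k \<omega>))
      = (\<Sum>j = 1..K. expectation (\<lambda>\<omega>. \<Sum>k = 1..K. inner (noise t j \<omega>) (noise t k \<omega>)))"
    using int by (intro Bochner_Integration.integral_sum Bochner_Integration.integrable_sum)
  also have "\<dots> = (\<Sum>j = 1..K. \<Sum>k = 1..K. expectation (\<lambda>\<omega>. inner (noise t j \<omega>) (noise t k \<omega>)))"
    using int by (intro sum.cong refl Bochner_Integration.integral_sum)
  also have "\<dots> = (\<Sum>j = 1..K. \<Sum>k = 1..K. if k = j then expectation (\<lambda>\<omega>. (norm (noise t j \<omega>))\<^sup>2) else 0)"
    using expectation_inner_noise_noise[OF t] by (intro sum.cong refl) (auto simp: power2_norm_eq_inner)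
  also have "\<dots> = (\<Sum>j = 1..K. expectation (\<lambda>\<omega>. (norm (noise t j \<omega>))\<^sup>2))"
    by (intro sum.cong refl) (simp add: sum.delta)
  also have "(1 / real K)\<^sup>2 * \<dots> \<le> (1 / real K)\<^sup>2 * (\<Sum>j = 1..K. \<sigma>\<^sup>2)"
    using expectation_noise_le[OF t] by (intro mult_left_mono sum_mono) auto
  also have "\<dots> = \<sigma>\<^sup>2 / real K"
    using K by (simp add: power2_eq_square)
  finally show ?thesis .
qed

text \<open>Convexity moves the square inside the mean, and the Lipschitz condition turns gradients
  into points. The model cancels between \<open>half_model\<close> and \<open>z\<close>, leaving a
  worker error minus server error and mean worker error, the form of
  \<open>sum_power2_deviation_le\<close>.\<close>

lemma mean_m_deviation_le:
  "(norm (mean_m t \<omega> - grad F (z t \<omega>)))\<^sup>2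
    \<le> L\<^sup>2 * ((1 / real K) * (\<Sum>k = 1..K. (norm (worker_err (S t \<omega>) k))\<^sup>2) + (norm (server_err (S t \<omega>)))\<^sup>2)"
proof -
  let ?e = "\<lambda>k. worker_err (S t \<omega>) k" and ?s = "server_err (S t \<omega>)"
  let ?c = "?s + (1 / real K) *\<^sub>R (\<Sum>k = 1..K. ?e k)"
  have "mean_m t \<omega> - grad F (z t \<omega>) = (1 / real K) *\<^sub>R (\<Sum>k = 1..K. m t k \<omega> - grad F (z t \<omega>))"
    using K by (simp add: mean_m_def sum_subtractf scaleR_diff_right sum_constant_scaleR)
  then have "(norm (mean_m t \<omega> - grad F (z t \<omega>)))\<^sup>2 \<le> (1 / real K) * (\<Sum>k = 1..K. (norm (m t k \<omega> - grad F (z t \<omega>)))\<^sup>2)"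
    using norm_mean_power2_le[where I = "{1..K}" and u = "\<lambda>k. m t k \<omega> - grad F (z t \<omega>)"] by simp
  also have "\<dots> \<le> (1 / real K) * (\<Sum>k = 1..K. L\<^sup>2 * (norm (?e k - ?c))\<^sup>2)"
  proof (intro mult_left_mono sum_mono)
    fix k
    have "norm (half_model (S t \<omega>) k - z t \<omega>) = norm (?e k - ?c)"
      unfolding half_model_def z_def aux_model_def by (subst norm_minus_commute) (simp add: algebra_simps)
    then show "(norm (m t k \<omega> - grad F (z t \<omega>)))\<^sup>2 \<le> L\<^sup>2 * (norm (?e k - ?c))\<^sup>2"
      using power_mono[OF lipschitz[of "half_model (S t \<omega>) k" "z t \<omega>"], of 2]
      by (simp add: m_def power_mult_distrib)
  qed simp
  also have "\<dots> = L\<^sup>2 * ((1 / real K) * (\<Sum>k = 1..K. (norm (?e k - ?c))\<^sup>2))"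
    by (simp add: sum_distrib_left[symmetric])
  also have "\<dots> \<le> L\<^sup>2 * ((1 / real K) * ((\<Sum>k = 1..K. (norm (?e k))\<^sup>2) + real K * (norm ?s)\<^sup>2))"
    using sum_power2_deviation_le[where I = "{1..K}" and u = ?e and c = ?s]
    by (intro mult_left_mono) auto
  also have "\<dots> = L\<^sup>2 * ((1 / real K) * (\<Sum>k = 1..K. (norm (?e k))\<^sup>2) + (norm ?s)\<^sup>2)"
    using K by (simp add: field_simps)
  finally show ?thesis .
qed

lemma expectation_mean_m_deviation_le:
  assumes t: "t < T"
  shows "expectation (\<lambda>\<omega>. (norm (mean_m t \<omega> - grad F (z t \<omega>)))\<^sup>2) \<le> L\<^sup>2 * R"
proof -
  let ?e = "\<lambda>k \<omega>. worker_err (S t \<omega>) k" and ?s = "\<lambda>\<omega>. server_err (S t \<omega>)"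
  have t': "t \<le> T" using t by simp
  have e: "integrable P (\<lambda>\<omega>. (norm (?e k \<omega>))\<^sup>2)"
    "expectation (\<lambda>\<omega>. (norm (?e k \<omega>))\<^sup>2) \<le> a\<^sup>2 * B / (1 - a)\<^sup>2" if "k \<in> {1..K}" for k
    using worker_err_bound[OF that t'] by (auto simp: square_integrable_norm)
  have s: "integrable P (\<lambda>\<omega>. (norm (?s \<omega>))\<^sup>2)"
    using server_err_bound[OF t'] by (simp add: square_integrable_norm)
  have int: "integrable P (\<lambda>\<omega>. \<Sum>k = 1..K. (norm (?e k \<omega>))\<^sup>2)"
    by (intro Bochner_Integration.integrable_sum e)
  have "expectation (\<lambda>\<omega>. (norm (mean_m t \<omega> - grad F (z t \<omega>)))\<^sup>2)
      \<le> expectation (\<lambda>\<omega>. L\<^sup>2 * ((1 / real K) * (\<Sum>k = 1..K. (norm (?e k \<omega>))\<^sup>2) + (norm (?s \<omega>))\<^sup>2))"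
    by (intro integral_mono mean_m_deviation_le square_integrable_norm square_integrable_diff
        square_integrable_mean_m square_integrable_grad_z t t' integrable_mult_right
        Bochner_Integration.integrable_add int s)
  also have "\<dots> = L\<^sup>2 * ((1 / real K) * expectation (\<lambda>\<omega>. \<Sum>k = 1..K. (norm (?e k \<omega>))\<^sup>2)
      + expectation (\<lambda>\<omega>. (norm (?s \<omega>))\<^sup>2))"
    using int s by simp
  also have "expectation (\<lambda>\<omega>. \<Sum>k = 1..K. (norm (?e k \<omega>))\<^sup>2) = (\<Sum>k = 1..K. expectation (\<lambda>\<omega>. (norm (?e k \<omega>))\<^sup>2))"
    by (intro Bochner_Integration.integral_sum e)
  also have "L\<^sup>2 * ((1 / real K) * \<dots> + expectation (\<lambda>\<omega>. (norm (?s \<omega>))\<^sup>2))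
      \<le> L\<^sup>2 * ((1 / real K) * (\<Sum>k = 1..K. a\<^sup>2 * B / (1 - a)\<^sup>2) + a\<^sup>2 * ((1 + a)\<^sup>2 * (B / (1 - a)\<^sup>2)) / (1 - a)\<^sup>2)"
    using server_err_bound[OF t'] by (intro mult_left_mono add_mono sum_mono e) auto
  also have "\<dots> = L\<^sup>2 * R"
    using K by (simp add: R_def distrib_left)
  finally show ?thesis .
qed

section \<open>Expected descent and telescoping\<close>

lemma expectation_F_step:
  assumes t: "t < T"
  shows "expectation (\<lambda>\<omega>. F (z (Suc t) \<omega>)) \<le> expectation (\<lambda>\<omega>. F (z t \<omega>))
    - \<eta> * (3 - 4 * \<eta> * L) / 4 * expectation (\<lambda>\<omega>. (norm (grad F (z t \<omega>)))\<^sup>2)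
    + \<eta> * (\<eta> * L + 1) * (L\<^sup>2 * R) + L * \<eta>\<^sup>2 / 2 * (\<sigma>\<^sup>2 / real K)"
proof -
  let ?G = "\<lambda>\<omega>. grad F (z t \<omega>)" and ?c = "\<eta> * (3 - 4 * \<eta> * L) / 4"
  \<comment> \<open>\<open>?U\<close> keeps both inner products with the mean noise as separate
    terms, because they vanish only in expectation, not on each sample path.\<close>
  let ?U = "\<lambda>\<omega>. F (z t \<omega>) - ?c * (norm (?G \<omega>))\<^sup>2
    + \<eta> * (\<eta> * L + 1) * (norm (mean_m t \<omega> - ?G \<omega>))\<^sup>2 - \<eta> * inner (?G \<omega>) (mean_noise t \<omega>)
    + L * \<eta>\<^sup>2 * inner (mean_m t \<omega>) (mean_noise t \<omega>) + L * \<eta>\<^sup>2 / 2 * (norm (mean_noise t \<omega>))\<^sup>2"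
  have t': "t \<le> T" "Suc t \<le> T" using t by auto
  have le: "F (z (Suc t) \<omega>) \<le> ?U \<omega>" for \<omega>
  proof -
    let ?m = "mean_m t \<omega>" and ?n = "mean_noise t \<omega>"
    have "F (z (Suc t) \<omega>) \<le> F (z t \<omega>) + inner (?G \<omega>) (z (Suc t) \<omega> - z t \<omega>)
        + L / 2 * (norm (z (Suc t) \<omega> - z t \<omega>))\<^sup>2"
      by (rule descent_lemma[OF F_diff lipschitz])
    also have "\<dots> = F (z t \<omega>) - \<eta> * inner (?G \<omega>) (?m + ?n) + L / 2 * (\<eta>\<^sup>2 * (norm (?m + ?n))\<^sup>2)"
      by (simp add: z_Suc_mean power_mult_distrib)
    also have "(norm (?m + ?n))\<^sup>2 = (norm ?m)\<^sup>2 + 2 * inner ?m ?n + (norm ?n)\<^sup>2"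
      by (simp add: power2_norm_eq_inner inner_commute algebra_simps)
    also have "F (z t \<omega>) - \<eta> * inner (?G \<omega>) (?m + ?n)
        + L / 2 * (\<eta>\<^sup>2 * ((norm ?m)\<^sup>2 + 2 * inner ?m ?n + (norm ?n)\<^sup>2))
      = F (z t \<omega>) + (- \<eta> * inner (?G \<omega>) ?m + L * \<eta>\<^sup>2 / 2 * (norm ?m)\<^sup>2)
        - \<eta> * inner (?G \<omega>) ?n + L * \<eta>\<^sup>2 * inner ?m ?n + L * \<eta>\<^sup>2 / 2 * (norm ?n)\<^sup>2"
      by (simp add: inner_add_right algebra_simps)
    also have "\<dots> \<le> ?U \<omega>"
      using biased_gradient_step_le[of \<eta> L "?G \<omega>" ?m] eta(1) L_pos by simp
    finally show ?thesis .
  qed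
  note si = square_integrable_grad_z[OF t'(1)] square_integrable_mean_m[OF t] square_integrable_mean_noise[OF t]
  note int = integrable_F_z[OF t'(1)] square_integrable_norm[OF si(1)]
    square_integrable_norm[OF square_integrable_diff[OF si(2,1)]] square_integrable_norm[OF si(3)]
    integrable_inner_square_integrable[OF si(1,3)] integrable_inner_square_integrable[OF si(2,3)]
  have "expectation (\<lambda>\<omega>. F (z (Suc t) \<omega>)) \<le> expectation ?U"
    using int by (intro integral_mono integrable_F_z t' le) auto
  also have "\<dots> = expectation (\<lambda>\<omega>. F (z t \<omega>)) - ?c * expectation (\<lambda>\<omega>. (norm (?G \<omega>))\<^sup>2)
      + \<eta> * (\<eta> * L + 1) * expectation (\<lambda>\<omega>. (norm (mean_m t \<omega> - ?G \<omega>))\<^sup>2)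
      + L * \<eta>\<^sup>2 / 2 * expectation (\<lambda>\<omega>. (norm (mean_noise t \<omega>))\<^sup>2)"
    using int expectation_inner_grad_z_mean_noise[OF t] expectation_inner_mean_m_mean_noise[OF t]
    by simp
  also have "\<dots> \<le> expectation (\<lambda>\<omega>. F (z t \<omega>)) - ?c * expectation (\<lambda>\<omega>. (norm (?G \<omega>))\<^sup>2)
      + \<eta> * (\<eta> * L + 1) * (L\<^sup>2 * R) + L * \<eta>\<^sup>2 / 2 * (\<sigma>\<^sup>2 / real K)"
    using eta(1) L_pos
    by (intro add_mono mult_left_mono order_refl expectation_mean_m_deviation_le expectation_mean_noise_le t) auto
  finally show ?thesis .
qed

text \<open>Summing the one-step decrease cancels the intermediate values of \<open>F\<close>. The
  initial one is deterministic, and the last is at least the minimum of \<open>F\<close>.\<close>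

lemma sum_expectation_grad_le:
  "\<eta> * (3 - 4 * \<eta> * L) / 4 * (\<Sum>t<T. expectation (\<lambda>\<omega>. (norm (grad F (z t \<omega>)))\<^sup>2))
    \<le> F (aux_model K (saef_init x0)) - F xstar
      + real T * (\<eta> * (\<eta> * L + 1) * (L\<^sup>2 * R) + L * \<eta>\<^sup>2 / 2 * (\<sigma>\<^sup>2 / real K))"
proof -
  let ?c = "\<eta> * (3 - 4 * \<eta> * L) / 4" and ?E = "\<lambda>t. expectation (\<lambda>\<omega>. (norm (grad F (z t \<omega>)))\<^sup>2)"
  let ?Q = "\<eta> * (\<eta> * L + 1) * (L\<^sup>2 * R) + L * \<eta>\<^sup>2 / 2 * (\<sigma>\<^sup>2 / real K)"
  have telescope: "?c * (\<Sum>t<n. ?E t)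
      \<le> F (aux_model K (saef_init x0)) - expectation (\<lambda>\<omega>. F (z n \<omega>)) + real n * ?Q"
    if "n \<le> T" for n
    using that
  proof (induction n)
    case 0
    then show ?case
      by (simp add: z_def S_0 prob_space)
  next
    case (Suc n)
    then have "?c * (\<Sum>t<n. ?E t) \<le> F (aux_model K (saef_init x0)) - expectation (\<lambda>\<omega>. F (z n \<omega>)) + real n * ?Q"
      by simp
    moreover have "?c * (\<Sum>t<Suc n. ?E t) = ?c * (\<Sum>t<n. ?E t) + ?c * ?E n"
      by (simp only: sum.lessThan_Suc distrib_left)
    moreover have "real (Suc n) * ?Q = real n * ?Q + ?Q"
      by (simp only: of_nat_Suc distrib_right mult_1 add.commute)
    ultimately show ?case
      using expectation_F_step[of n] Suc.prems by simp
  qed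
  have "F xstar \<le> expectation (\<lambda>\<omega>. F (z T \<omega>))"
    by (intro integral_ge_const integrable_F_z) (auto intro: minimizer)
  then show ?thesis
    using telescope[OF order_refl] by linarith
qed

lemma min_expectation_grad_le:
  "Min ((\<lambda>t. expectation (\<lambda>\<omega>. (norm (grad F (z t \<omega>)))\<^sup>2)) ` {..<T})
    \<le> 4 * (F (aux_model K (saef_init x0)) - F xstar) / (\<eta> * (3 - 4 * \<eta> * L) * real T)
      + 2 * \<eta> * L * \<sigma>\<^sup>2 / ((3 - 4 * \<eta> * L) * real K)
      + 4 * (\<eta> * L + 1) * L\<^sup>2 / (3 - 4 * \<eta> * L) * R"
proof -
  let ?E = "\<lambda>t. expectation (\<lambda>\<omega>. (norm (grad F (z t \<omega>)))\<^sup>2)"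
  let ?q = "3 - 4 * \<eta> * L" and ?D = "F (aux_model K (saef_init x0)) - F xstar"
  let ?Q = "\<eta> * (\<eta> * L + 1) * (L\<^sup>2 * R) + L * \<eta>\<^sup>2 / 2 * (\<sigma>\<^sup>2 / real K)"
  \<comment> \<open>Stated for an arbitrary nonzero \<open>q\<close>, so that simplification treats
    \<open>3 - 4 * \<eta> * L\<close> as an atom instead of multiplying it out.\<close>
  have Q: "?Q / (\<eta> * q / 4) = 2 * \<eta> * L * \<sigma>\<^sup>2 / (q * real K) + 4 * (\<eta> * L + 1) * L\<^sup>2 / q * R"
    if "q \<noteq> 0" for q
    using that eta(1) K by (simp add: field_simps power2_eq_square)
  have c: "0 < \<eta> * ?q / 4"
    using eta(1) eta_L by simp
  \<comment> \<open>The minimum is at most the average, so the bound on the sum transfers to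
    it.\<close>
  have "real T * Min (?E ` {..<T}) = (\<Sum>t<T. Min (?E ` {..<T}))"
    by simp
  also have "\<dots> \<le> (\<Sum>t<T. ?E t)"
    by (intro sum_mono Min_le) auto
  finally have "\<eta> * ?q / 4 * (real T * Min (?E ` {..<T})) \<le> \<eta> * ?q / 4 * (\<Sum>t<T. ?E t)"
    using c by (intro mult_left_mono) auto
  also have "\<dots> \<le> ?D + real T * ?Q"
    by (rule sum_expectation_grad_le)
  finally have "Min (?E ` {..<T}) * (\<eta> * ?q / 4 * real T) \<le> ?D + real T * ?Q"
    by (simp only: mult_ac)
  moreover have "0 < \<eta> * ?q / 4 * real T"
    using c T by simp
  ultimately have "Min (?E ` {..<T}) \<le> (?D + real T * ?Q) / (\<eta> * ?q / 4 * real T)"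
    by (simp only: pos_le_divide_eq)
  also have "\<dots> = ?D / (\<eta> * ?q / 4 * real T) + ?Q / (\<eta> * ?q / 4)"
    using T by (simp add: add_divide_distrib)
  also have "?D / (\<eta> * ?q / 4 * real T) = 4 * ?D / (\<eta> * ?q * real T)"
    by simp
  also have "?Q / (\<eta> * ?q / 4) = 2 * \<eta> * L * \<sigma>\<^sup>2 / (?q * real K) + 4 * (\<eta> * L + 1) * L\<^sup>2 / ?q * R"
    using eta_L by (intro Q) simp
  finally show ?thesis
    by (simp only: add.assoc)
qed

lemma R_le:
  assumes "C = 2 * (1 + \<delta>) * (2 - \<delta>) / (1 - sqrt (1 - \<delta>))\<^sup>2 + (1 + \<delta>) / \<delta>"
  shows "R \<le> C * (1 - \<delta>) / (1 - sqrt (1 - \<delta>))\<^sup>2 * \<eta>\<^sup>2 * (M\<^sup>2 + \<sigma>\<^sup>2)"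
proof -
  have "R \<le> a\<^sup>2 * B / (1 - a)\<^sup>2 * C"
    unfolding R_def assms a_def using compression_constant_ge[OF delta] B_nonneg
    by (intro mult_left_mono) auto
  also have "\<dots> = C * (1 - \<delta>) / (1 - sqrt (1 - \<delta>))\<^sup>2 * \<eta>\<^sup>2 * (M\<^sup>2 + \<sigma>\<^sup>2)"
    unfolding a_power2 B_def by (simp add: a_def mult_ac)
  finally show ?thesis .
qed

end

theorem theorem1:
  fixes P :: "'w measure" and D :: "'s measure"
    and f :: "'a::euclidean_space \<Rightarrow> 's \<Rightarrow> real" and F :: "'a \<Rightarrow> real"
    and Comp :: "'a \<Rightarrow> 'a"
    and \<xi> :: "nat \<Rightarrow> nat \<Rightarrow> 'w \<Rightarrow> 's"
    and S :: "nat \<Rightarrow> 'w \<Rightarrow> 'a saef_state"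
    and x0 xstar :: 'a
    and K T :: nat
    and \<eta> L \<sigma> M \<delta> C :: real
  assumes K: "K \<ge> 1" and T: "T \<ge> 1"
    and prob: "prob_space P"
    \<comment> \<open>independent samples with law \<open>D\<close>\<close>
    and indep: "prob_space.indep_vars P (\<lambda>_. D) (\<lambda>(k, t). \<xi> k t) ({1..K} \<times> {..<T})"
    and law: "\<And>k t. k \<in> {1..K} \<Longrightarrow> t < T \<Longrightarrow> distr P D (\<xi> k t) = D"
    \<comment> \<open>objective, minimizer and unbiased stochastic gradients\<close>
    and f_integrable: "\<And>x. integrable D (f x)"
    and F_eq: "\<And>x. F x = (\<integral>s. f x s \<partial>D)"
    and minimizer: "\<And>x. F xstar \<le> F x"
    and f_diff: "\<And>x s. s \<in> space D \<Longrightarrow> (\<lambda>y. f y s) differentiable (at x)"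
    and grad_integrable: "\<And>x. integrable D (stoch_grad f x)"
    and unbiased: "\<And>x. (\<integral>s. stoch_grad f x s \<partial>D) = grad F x"
    \<comment> \<open>SAEF-SGD with constant learning rate\<close>
    and Comp_measurable: "Comp \<in> borel_measurable borel"
    and S_eq: "\<And>t \<omega>. S t \<omega> = saef Comp (stoch_grad f) (\<lambda>_. \<eta>) K x0 (\<lambda>k i. \<xi> k i \<omega>) t"
    and eta: "0 < \<eta>" "\<eta> < 3 / (4 * L)"
    \<comment> \<open>(A1)\<close>
    and F_diff: "\<And>x. F differentiable (at x)"
    and lipschitz: "\<And>x y. norm (grad F x - grad F y) \<le> L * norm (x - y)"
    \<comment> \<open>(A2)\<close>
    and variance: "\<And>k t. k \<in> {1..K} \<Longrightarrow> t < T \<Longrightarrow>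
        expectation_le P (\<lambda>\<omega>. (norm (stoch_grad f (model (S t \<omega>)) (\<xi> k t \<omega>)
          - grad F (model (S t \<omega>))))\<^sup>2) (\<sigma>\<^sup>2)"
    and variance_half: "\<And>k t. k \<in> {1..K} \<Longrightarrow> t < T \<Longrightarrow>
        expectation_le P (\<lambda>\<omega>. (norm (stoch_grad f (half_model (S t \<omega>) k) (\<xi> k t \<omega>)
          - grad F (half_model (S t \<omega>) k)))\<^sup>2) (\<sigma>\<^sup>2)"
    \<comment> \<open>(A3)\<close>
    and bounded: "\<And>t. t < T \<Longrightarrow> AE \<omega> in P. (norm (grad F (model (S t \<omega>))))\<^sup>2 \<le> M\<^sup>2"
    and bounded_half: "\<And>k t. k \<in> {1..K} \<Longrightarrow> t < T \<Longrightarrow>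
        AE \<omega> in P. (norm (grad F (half_model (S t \<omega>) k)))\<^sup>2 \<le> M\<^sup>2"
    \<comment> \<open>(A4)\<close>
    and delta: "0 < \<delta>" "\<delta> \<le> 1"
    and compressor: "\<And>v. (norm (Comp v - v))\<^sup>2 \<le> (1 - \<delta>) * (norm v)\<^sup>2"
    and C_eq: "C = 2 * (1 + \<delta>) * (2 - \<delta>) / (1 - sqrt (1 - \<delta>))\<^sup>2 + (1 + \<delta>) / \<delta>"
  shows "(\<forall>t < T. integrable P (\<lambda>\<omega>. (norm (grad F (aux_model K (S t \<omega>))))\<^sup>2)) \<and>
    Min ((\<lambda>t. \<integral>\<omega>. (norm (grad F (aux_model K (S t \<omega>))))\<^sup>2 \<partial>P) ` {..<T})
      \<le> 4 * (F (aux_model K (saef_init x0)) - F xstar) / (\<eta> * (3 - 4 * \<eta> * L) * real T)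
        + 2 * \<eta> * L * \<sigma>\<^sup>2 / ((3 - 4 * \<eta> * L) * real K)
        + C * (1 - \<delta>) / (1 - sqrt (1 - \<delta>))\<^sup>2
          * (4 * (\<eta> * L + 1) * \<eta>\<^sup>2 * L\<^sup>2 / (3 - 4 * \<eta> * L)) * (M\<^sup>2 + \<sigma>\<^sup>2)"
proof -
  interpret run: saef_sgd P D f F Comp \<xi> S x0 xstar K T \<eta> L \<sigma> M \<delta>
  proof (rule saef_sgd.intro[OF prob], unfold_locales)
    show "f x \<in> borel_measurable D" for x
      using f_integrable by (rule borel_measurable_integrable)
  qed fact+
  \<comment> \<open>Integrability ensures that the integrals in the minimum are true second moments
    and not the default value 0.\<close>
  have int: "integrable P (\<lambda>\<omega>. (norm (grad F (aux_model K (S t \<omega>))))\<^sup>2)" if "t < T" for t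
    using square_integrable_norm[OF run.square_integrable_grad_z[of t]] that by (simp add: run.z_def)
  \<comment> \<open>\<open>?c\<close> is the factor of \<open>R\<close> in
    \<open>min_expectation_grad_le\<close>. It is positive, so \<open>R\<close> may be replaced by
    its upper bound in terms of \<open>C\<close>.\<close>
  let ?c = "4 * (\<eta> * L + 1) * L\<^sup>2 / (3 - 4 * \<eta> * L)"
  have "?c * run.R \<le> ?c * (C * (1 - \<delta>) / (1 - sqrt (1 - \<delta>))\<^sup>2 * \<eta>\<^sup>2 * (M\<^sup>2 + \<sigma>\<^sup>2))"
    using run.eta_L run.L_pos eta(1) by (intro mult_left_mono run.R_le C_eq) auto
  also have "\<dots> = C * (1 - \<delta>) / (1 - sqrt (1 - \<delta>))\<^sup>2
      * (4 * (\<eta> * L + 1) * \<eta>\<^sup>2 * L\<^sup>2 / (3 - 4 * \<eta> * L)) * (M\<^sup>2 + \<sigma>\<^sup>2)"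
    by (simp add: mult_ac)
  finally show ?thesis
    using run.min_expectation_grad_le int unfolding run.z_def by simp
qed

end
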